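(* Let $N\geq 2$, $b>0$, $p\geq 1+\frac{2b}{N-1}$, and, if $N\geq 3$, $p\leq\frac{N+2+2b}{N-2}$. Then there exists a constant $C(N,p,b)>0$ such that $$\int_{\mathbb R^N}|x|^b|f(x)|^{p+1}\,dx\leq C(N,p,b)\,\|\nabla f\|_{L^2}^{\frac{N(p-1)-2b}{2}}\,\|f\|_{L^2}^{\frac{4+2b-(N-2)(p-1)}{2}}\qquad\text{for all } f\in H^1_{\mathrm{rad}}(\mathbb R^N).$$
   Context: $H^1_{\mathrm{rad}}(\mathbb R^N)$ is the space of radial functions (complex-valued) in $H^1(\mathbb R^N)$. *)

theory Defs
  imports "HOL-Analysis.Analysis"
begin

text \<open>Functions on \<open>\<real>\<^sup>N\<close> are represented by Lebesgue measurable functions on \<^typ>\<open>real ^ 'n\<close>,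
  with \<open>N = CARD('n)\<close>; almost everywhere equal functions are not identified.\<close>

definition partial_deriv ::
  "'n::finite \<Rightarrow> (real ^ 'n \<Rightarrow> real) \<Rightarrow> real ^ 'n \<Rightarrow> real"
  where "partial_deriv i \<phi> x = frechet_derivative \<phi> (at x) (axis i 1)"

primrec C_k :: "nat \<Rightarrow> (real ^ 'n::finite \<Rightarrow> real) \<Rightarrow> bool" where
  "C_k 0 \<phi> \<longleftrightarrow> continuous_on UNIV \<phi>"
| "C_k (Suc k) \<phi> \<longleftrightarrow> \<phi> differentiable_on UNIV \<and> (\<forall>i. C_k k (partial_deriv i \<phi>))"

definition test_functions :: "(real ^ 'n::finite \<Rightarrow> real) set"
  where "test_functions = {\<phi>. (\<forall>k. C_k k \<phi>) \<and> compact (closure {x. \<phi> x \<noteq> 0})}"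

definition L2 :: "(real ^ 'n::finite \<Rightarrow> 'b::euclidean_space) set"
  where "L2 = {f \<in> borel_measurable lebesgue. integrable lebesgue (\<lambda>x. (norm (f x))\<^sup>2)}"

definition L2_norm :: "(real ^ 'n::finite \<Rightarrow> 'b::euclidean_space) \<Rightarrow> real"
  where "L2_norm f = sqrt (\<integral>x. (norm (f x))\<^sup>2 \<partial>lebesgue)"

text \<open>Real test functions suffice: complex ones give the same identities by linearity.\<close>

definition is_weak_gradient ::
  "(real ^ 'n::finite \<Rightarrow> complex) \<Rightarrow> (real ^ 'n \<Rightarrow> complex ^ 'n) \<Rightarrow> bool"
  where "is_weak_gradient f G \<longleftrightarrow>
    (\<forall>\<phi>\<in>test_functions. \<forall>i.
      (\<integral>x. partial_deriv i \<phi> x *\<^sub>R f x \<partial>lebesgue) = - (\<integral>x. \<phi> x *\<^sub>R (G x $ i) \<partial>lebesgue))"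

definition H1 :: "(real ^ 'n::finite \<Rightarrow> complex) set"
  where "H1 = {f \<in> L2. \<exists>G\<in>L2. is_weak_gradient f G}"

text \<open>For \<open>f\<close> in \<open>H1\<close> the square integrable weak gradient is unique up to null sets, so its
  \<open>L\<^sup>2\<close> norm does not depend on the choice made here.\<close>

definition weak_gradient ::
  "(real ^ 'n::finite \<Rightarrow> complex) \<Rightarrow> real ^ 'n \<Rightarrow> complex ^ 'n"
  where "weak_gradient f = (SOME G. G \<in> L2 \<and> is_weak_gradient f G)"

text \<open>Radiality is a property of the almost everywhere class of \<open>f\<close>.\<close>

definition radial :: "(real ^ 'n::finite \<Rightarrow> complex) \<Rightarrow> bool"
  where "radial f \<longleftrightarrow> (\<exists>g :: real \<Rightarrow> complex. AE x in lebesgue. f x = g (norm x))"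

definition H1_rad :: "(real ^ 'n::finite \<Rightarrow> complex) set"
  where "H1_rad = {f \<in> H1. radial f}"

end

theory Submission
  imports Defs
begin

text \<open>Write \<open>N\<close> for the dimension, \<open>A = \<parallel>f\<parallel>\<close> and \<open>B = \<parallel>\<nabla>f\<parallel>\<close> in \<open>L\<^sup>2\<close>. The powers of \<open>A\<close> and \<open>B\<close> in the
  inequality are dictated by scaling, and \<open>A / B\<close> is the only length that they determine. The integral is
  split at the sphere of that radius, called critical below: outside it the decay of radial \<open>H\<^sup>1\<close> functions at infinity
  controls the weight, inside it their limited growth at the origin does.

  A radial \<open>H\<^sup>1\<close> function depends on one variable, here \<open>\<rho> = |x|\<^sup>2\<close> rather than \<open>|x|\<close> because \<open>\<rho>\<close> is
  smooth in \<open>x\<close> and radial test fields are then polynomials in \<open>x\<close> times smooth functions of \<open>\<rho>\<close>. Testing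
  the weak gradient \<open>G\<close> with the fields \<open>|x|\<^sup>-\<^sup>N Z(\<rho>) x\<close>, where \<open>Z\<close> has compact support in the open half line,
  and applying the du Bois-Reymond lemma shows that \<open>f = u(|x|\<^sup>2)\<close> almost everywhere for a function \<open>u\<close>
  with
    \<open>|u(\<tau>) - u(\<sigma>)| \<le> 1/S \<integral> {\<sigma> \<le> |x|\<^sup>2 < \<tau>} |x|\<^sup>1\<^sup>-\<^sup>N |G(x)| dx\<close>,
  where \<open>S\<close> is the area of the unit sphere (\<open>weak_radial_representative\<close>). No radial derivative of \<open>u\<close> is
  formed: the increments are integrals over shells in \<open>\<real>\<^sup>N\<close>, and everything that follows is deduced
  from this one bound by the Cauchy-Schwarz inequality with a power weight (\<open>increment_power2\<close>).

  Averaging \<open>u\<close> over a short interval behind \<open>\<sigma>\<close> gives the radial lemma of Strauss,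
  \<open>|x|\<^sup>N\<^sup>-\<^sup>1 |f|\<^sup>2 \<le> C A B\<close> (\<open>decay\<close>). With the lower bound on \<open>p\<close> it makes \<open>|x|\<^sup>b |f|\<^sup>p\<^sup>-\<^sup>1\<close> bounded outside the critical
  sphere, and the remaining factor \<open>|f|\<^sup>2\<close> integrates to at most \<open>A\<^sup>2\<close> (\<open>outer_bound\<close>).

  Inside, if \<open>N \<ge> 3\<close>, integrating the increments from infinity gives \<open>|x|\<^sup>N\<^sup>-\<^sup>2 |f|\<^sup>2 \<le> C B\<^sup>2\<close> (\<open>pointwise_bound\<close>)
  and the inequality of Hardy, \<open>\<integral> |f|\<^sup>2 / |x|\<^sup>2 \<le> C B\<^sup>2\<close> (\<open>hardy\<close>). The upper bound on \<open>p\<close> says exactly that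
  \<open>|x|\<^sup>b\<^sup>+\<^sup>2 |f|\<^sup>p\<^sup>-\<^sup>1\<close> is then bounded inside, the critical exponent included (\<open>inner_bound_high_dim\<close>). If
  \<open>N = 2\<close>, both bounds fail logarithmically, but \<open>|f|\<^sup>2 \<le> C B\<^sup>2 (A / (B |x|))\<^sup>2\<^sup>\<epsilon>\<close> inside for every \<open>\<epsilon> > 0\<close>, and since
  \<open>b > 0\<close> a suitable \<open>\<epsilon>\<close> lets the weight \<open>|x|\<^sup>b\<close> absorb this growth (\<open>inner_bound_dim_2\<close>).\<close>

section \<open>Smooth functions of one variable\<close>

text \<open>The derivative is existentially quantified in each step, so that the closure properties below are inductions
  in which only the first derivative has to be exhibited. All functions of this kind that are used later
  are smooth, that is, \<open>Ck_on k S f\<close> holds for every \<open>k\<close>.\<close>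
primrec Ck_on :: "nat \<Rightarrow> real set \<Rightarrow> (real \<Rightarrow> real) \<Rightarrow> bool" where
  "Ck_on 0 S f \<longleftrightarrow> continuous_on S f"
| "Ck_on (Suc k) S f \<longleftrightarrow>
    (\<exists>f'. (\<forall>x\<in>S. (f has_real_derivative f' x) (at x)) \<and> Ck_on k S f')"

lemma Ck_on_SucI:
  "(\<And>x. x \<in> S \<Longrightarrow> (f has_real_derivative f' x) (at x)) \<Longrightarrow> Ck_on k S f' \<Longrightarrow> Ck_on (Suc k) S f"
  by auto

lemma Ck_on_imp_continuous_on: "Ck_on k S f \<Longrightarrow> continuous_on S f"
  by (cases k) (auto intro: continuous_at_imp_continuous_on DERIV_isCont)

lemma Ck_on_SucD: "Ck_on (Suc k) S f \<Longrightarrow> Ck_on k S f"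
proof (induction k arbitrary: f)
  case 0
  from Ck_on_imp_continuous_on[OF this] show ?case by simp
next
  case (Suc k)
  from Suc.prems obtain f' where f': "\<forall>x\<in>S. (f has_real_derivative f' x) (at x)" "Ck_on (Suc k) S f'"
    unfolding Ck_on.simps(2)[of "Suc k"] by blast
  from f'(1) Suc.IH[OF f'(2)] show ?case unfolding Ck_on.simps(2)[of k] by blast
qed

lemma Ck_on_subset: "Ck_on k S f \<Longrightarrow> T \<subseteq> S \<Longrightarrow> Ck_on k T f"
  by (induction k arbitrary: f) (auto intro: continuous_on_subset)

lemma Ck_on_cong:
  assumes "open S" "\<And>x. x \<in> S \<Longrightarrow> f x = g x" "Ck_on k S f"
  shows "Ck_on k S g"
proof (cases k)
  case 0
  then show ?thesis using assms by (simp cong: continuous_on_cong)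
next
  case (Suc j)
  then obtain f' where f': "\<forall>x\<in>S. (f has_real_derivative f' x) (at x)" "Ck_on j S f'"
    using assms(3) by auto
  have "(g has_real_derivative f' x) (at x)" if "x \<in> S" for x
    using f'(1) that assms(1,2) by (metis has_field_derivative_transform_within_open)
  with f'(2) Suc show ?thesis by auto
qed

text \<open>Smoothness is local. This glues \<open>t\<^sup>a\<close> times a function vanishing near \<open>0\<close> to the zero function on the rest of
  the line.\<close>
lemma Ck_on_Un:
  assumes "open S" "open T" "Ck_on k S f" "Ck_on k T f"
  shows "Ck_on k (S \<union> T) f"
  using assms(3,4)
proof (induction k arbitrary: f)
  case 0
  then show ?case using assms by (simp add: continuous_on_open_Un)
next
  case (Suc k)
  obtain g where g: "\<forall>x\<in>S. (f has_real_derivative g x) (at x)" "Ck_on k S g"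
    using Suc.prems by auto
  obtain h where h: "\<forall>x\<in>T. (f has_real_derivative h x) (at x)" "Ck_on k T h"
    using Suc.prems by auto
  define f' where "f' x = (if x \<in> S then g x else h x)" for x
  have eq: "f' x = h x" if "x \<in> T" for x
    using g(1) h(1) that DERIV_unique[of f "g x" x "h x"] unfolding f'_def by simp
  have "Ck_on k S f'"
    by (rule Ck_on_cong[OF assms(1) _ g(2)]) (simp add: f'_def)
  moreover have "Ck_on k T f'"
    by (rule Ck_on_cong[OF assms(2) _ h(2)]) (simp add: eq)
  ultimately have "Ck_on k (S \<union> T) f'" by (rule Suc.IH)
  moreover have "\<forall>x\<in>S \<union> T. (f has_real_derivative f' x) (at x)"
    using g h unfolding f'_def by auto
  ultimately show ?case by auto
qed

lemma Ck_on_const: "Ck_on k S (\<lambda>x. c)"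
proof (induction k arbitrary: c)
  case (Suc k)
  show ?case by (rule Ck_on_SucI[OF _ Suc[of 0]]) simp
qed simp

lemma Ck_on_add: "Ck_on k S f \<Longrightarrow> Ck_on k S g \<Longrightarrow> Ck_on k S (\<lambda>x. f x + g x)"
proof (induction k arbitrary: f g)
  case 0
  then show ?case by (simp add: continuous_on_add)
next
  case (Suc k)
  then obtain f' g' where fg:
    "\<forall>x\<in>S. (f has_real_derivative f' x) (at x)" "Ck_on k S f'"
    "\<forall>x\<in>S. (g has_real_derivative g' x) (at x)" "Ck_on k S g'" by auto
  have "Ck_on k S (\<lambda>x. f' x + g' x)" by (rule Suc.IH[OF fg(2) fg(4)])
  moreover have "\<forall>x\<in>S. ((\<lambda>x. f x + g x) has_real_derivative f' x + g' x) (at x)"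
    using fg by (auto intro!: derivative_intros)
  ultimately show ?case by auto
qed

lemma Ck_on_mult: "Ck_on k S f \<Longrightarrow> Ck_on k S g \<Longrightarrow> Ck_on k S (\<lambda>x. f x * g x)"
proof (induction k arbitrary: f g)
  case 0
  then show ?case by (simp add: continuous_on_mult)
next
  case (Suc k)
  then obtain f' g' where fg:
    "\<forall>x\<in>S. (f has_real_derivative f' x) (at x)" "Ck_on k S f'"
    "\<forall>x\<in>S. (g has_real_derivative g' x) (at x)" "Ck_on k S g'" by auto
  have "Ck_on k S (\<lambda>x. f' x * g x + g' x * f x)"
    by (intro Ck_on_add Suc.IH fg Ck_on_SucD[OF Suc.prems(1)] Ck_on_SucD[OF Suc.prems(2)])
  moreover have "\<forall>x\<in>S. ((\<lambda>x. f x * g x) has_real_derivative f' x * g x + g' x * f x) (at x)"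
    using fg by (auto intro!: derivative_intros)
  ultimately show ?case by auto
qed

lemma Ck_on_compose:
  assumes "Ck_on k T f" "Ck_on k S g" "\<And>x. x \<in> S \<Longrightarrow> g x \<in> T"
  shows "Ck_on k S (\<lambda>x. f (g x))"
  using assms(1,2)
proof (induction k arbitrary: f)
  case 0
  then show ?case using assms(3) by (auto intro: continuous_on_compose2)
next
  case (Suc k)
  then obtain f' g' where fg:
    "\<forall>x\<in>T. (f has_real_derivative f' x) (at x)" "Ck_on k T f'"
    "\<forall>x\<in>S. (g has_real_derivative g' x) (at x)" "Ck_on k S g'" by auto
  have "Ck_on k S (\<lambda>x. f' (g x) * g' x)"
    by (rule Ck_on_mult[OF Suc.IH[OF fg(2) Ck_on_SucD[OF Suc.prems(2)]] fg(4)])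
  moreover have "\<forall>x\<in>S. ((\<lambda>x. f (g x)) has_real_derivative f' (g x) * g' x) (at x)"
    using fg assms(3) by (metis DERIV_chain2)
  ultimately show ?case by auto
qed

lemma Ck_on_ident: "Ck_on k S (\<lambda>x. x)"
proof (cases k)
  case (Suc j)
  show ?thesis unfolding Suc by (rule Ck_on_SucI[OF _ Ck_on_const[of j S 1]]) simp
qed simp

lemma Ck_on_exp: "Ck_on k S exp"
  by (induction k) (auto intro!: continuous_intros exI[of _ exp])

lemma Ck_on_powr: "Ck_on k {0<..} (\<lambda>x. x powr a)"
proof (induction k arbitrary: a)
  case 0
  then show ?case by (auto intro!: continuous_intros)
next
  case (Suc k)
  have "Ck_on k {0<..} (\<lambda>x. a * x powr (a - 1))"
    using Ck_on_const Suc by (rule Ck_on_mult)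
  then show ?case
    by (auto intro!: exI[of _ "\<lambda>x. a * x powr (a - 1)"] has_real_derivative_powr)
qed

text \<open>The standard function that is smooth but not analytic at \<open>0\<close>; all bump functions are built from it.\<close>
definition flat_exp :: "real \<Rightarrow> real" where
  "flat_exp t = (if t > 0 then exp (- (1 / t)) else 0)"

lemma poly_over_exp_tendsto_0: "((\<lambda>y. poly p y * exp (- y)) \<longlongrightarrow> (0::real)) at_top"
proof -
  have "((\<lambda>y. \<Sum>i\<le>degree p. coeff p i * (y ^ i / exp y)) \<longlongrightarrow> (\<Sum>i\<le>degree p. coeff p i * 0)) at_top"
    by (intro tendsto_intros tendsto_power_div_exp_0)
  then show ?thesis
    by (simp add: poly_altdef sum_divide_distrib exp_minus field_simps)
qed

text \<open>The derivatives of the flat function are again of the form polynomial in the reciprocal times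
  the flat function, which gives a statement that is closed under differentiation.\<close>
lemma Ck_on_poly_flat_exp:
  "Ck_on k UNIV (\<lambda>t. if t > 0 then poly p (1 / t) * exp (- (1 / t)) else 0)"
proof -
  have der: "((\<lambda>t. if t > 0 then poly p (1 / t) * exp (- (1 / t)) else 0) has_real_derivative
      (if x > 0 then poly ([:0,0,1:] * (p - pderiv p)) (1 / x) * exp (- (1 / x)) else 0)) (at x)"
    (is "(?f has_real_derivative ?f' x) (at x)") for x and p :: "real poly"
  proof -
    consider "x > 0" | "x < 0" | "x = 0" by linarith
    then show ?thesis
    proof cases
      case 1
      have "((\<lambda>t. poly p (1 / t) * exp (- (1 / t))) has_real_derivative ?f' x) (at x)"
        using 1 by (auto intro!: derivative_eq_intros DERIV_chain2[OF poly_DERIV]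
            simp: power2_eq_square field_simps)
      then show ?thesis
        by (rule has_field_derivative_transform_within_open[of _ _ _ "{0<..}"]) (use 1 in auto)
    next
      case 2
      have "((\<lambda>t. 0) has_real_derivative ?f' x) (at x)"
        using 2 by auto
      then show ?thesis
        by (rule has_field_derivative_transform_within_open[of _ _ _ "{..<0}"]) (use 2 in auto)
    next
      case 3
      have lim: "((\<lambda>t. poly ([:0,1:] * p) (1 / t) * exp (- (1 / t))) \<longlongrightarrow> 0) (at_right (0::real))"
        using filterlim_compose[OF poly_over_exp_tendsto_0[of "[:0,1:] * p"] filterlim_inverse_at_top_right]
        by (simp add: inverse_eq_divide)
      have "((\<lambda>h. (?f (0 + h) - ?f 0) / h) \<longlongrightarrow> 0) (at 0)"
      proof (rule filterlim_split_at)
        show "((\<lambda>h. (?f (0 + h) - ?f 0) / h) \<longlongrightarrow> 0) (at_left 0)"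
          by (rule tendsto_eventually) (auto simp: eventually_at_filter)
        show "((\<lambda>h. (?f (0 + h) - ?f 0) / h) \<longlongrightarrow> 0) (at_right 0)"
          by (rule Lim_transform_eventually[OF lim])
             (auto simp: eventually_at_filter field_simps)
      qed
      then show ?thesis using 3 by (simp add: DERIV_def)
    qed
  qed
  show ?thesis
  proof (induction k arbitrary: p)
    case 0
    show ?case using der by (auto intro!: DERIV_continuous_on)
  next
    case (Suc k)
    show ?case by (rule Ck_on_SucI[OF der Suc])
  qed
qed

lemma Ck_on_flat_exp: "Ck_on k S flat_exp"
proof -
  have "flat_exp = (\<lambda>t. if t > 0 then poly 1 (1 / t) * exp (- (1 / t)) else 0)"
    by (auto simp: flat_exp_def fun_eq_iff)
  then show ?thesis using Ck_on_poly_flat_exp[of k 1] Ck_on_subset[of k UNIV flat_exp S] by simp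
qed

text \<open>Smooth functions that vanish off the interval and increase to its indicator as \<open>n\<close> grows. They replace a mollification of the indicator.\<close>
definition smooth_box :: "nat \<Rightarrow> real \<Rightarrow> real \<Rightarrow> real \<Rightarrow> real" where
  "smooth_box n a b t = 1 - exp (- (real n * (flat_exp (t - a) * flat_exp (b - t))))"

lemma Ck_on_smooth_box: "Ck_on k S (smooth_box n a b)"
proof -
  have 1: "Ck_on k S (\<lambda>t. flat_exp (t + (- a)))"
    by (intro Ck_on_compose[OF Ck_on_flat_exp[of k UNIV]] Ck_on_add Ck_on_const Ck_on_ident) auto
  have 2: "Ck_on k S (\<lambda>t. flat_exp (b + (-1) * t))"
    by (intro Ck_on_compose[OF Ck_on_flat_exp[of k UNIV]] Ck_on_add Ck_on_mult Ck_on_const Ck_on_ident) auto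
  have "Ck_on k S (\<lambda>t. 1 + (-1) * exp ((- real n) * (flat_exp (t + (- a)) * flat_exp (b + (-1) * t))))"
    by (intro Ck_on_add Ck_on_mult Ck_on_const Ck_on_compose[OF Ck_on_exp[of k UNIV]] 1 2) auto
  then show ?thesis by (simp add: smooth_box_def[abs_def])
qed

lemma flat_exp_nonneg: "flat_exp t \<ge> 0" by (simp add: flat_exp_def)

lemma smooth_box_bounds: "0 \<le> smooth_box n a b t" "smooth_box n a b t \<le> 1"
  by (auto simp: smooth_box_def flat_exp_nonneg)

lemma smooth_box_eq_0: "t \<notin> {a<..<b} \<Longrightarrow> smooth_box n a b t = 0"
  by (auto simp: smooth_box_def flat_exp_def)

lemma smooth_box_pos: "t \<in> {a<..<b} \<Longrightarrow> n > 0 \<Longrightarrow> smooth_box n a b t > 0"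
  by (auto simp: smooth_box_def flat_exp_def)

lemma smooth_box_tendsto:
  "(\<lambda>n. smooth_box n a b t) \<longlonglongrightarrow> indicator {a<..<b} t"
proof (cases "t \<in> {a<..<b}")
  case True
  define c where "c = flat_exp (t - a) * flat_exp (b - t)"
  have "c > 0" using True by (auto simp: c_def flat_exp_def)
  have "(\<lambda>n. 1 - exp (- c) ^ n) \<longlonglongrightarrow> 1 - 0"
    by (intro tendsto_intros LIMSEQ_realpow_zero) (use \<open>c > 0\<close> in auto)
  then show ?thesis using True
    by (simp add: smooth_box_def c_def flip: exp_of_nat_mult)
next
  case False
  then show ?thesis by (simp add: smooth_box_eq_0)
qed

section \<open>Radial test functions\<close>

lemma C_k_imp_continuous_on: "C_k k \<phi> \<Longrightarrow> continuous_on UNIV \<phi>"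
  by (cases k) (auto intro: differentiable_imp_continuous_on)

lemma C_k_SucD: "C_k (Suc k) \<phi> \<Longrightarrow> C_k k \<phi>"
proof (induction k arbitrary: \<phi>)
  case 0
  from C_k_imp_continuous_on[OF this] show ?case by simp
next
  case (Suc k)
  then show ?case unfolding C_k.simps(2)[of "Suc k"] C_k.simps(2)[of k] by blast
qed

lemma partial_deriv_eq: "(\<phi> has_derivative D) (at x) \<Longrightarrow> partial_deriv i \<phi> x = D (axis i 1)"
  by (simp add: partial_deriv_def frechet_derivative_at[symmetric])

text \<open>The derivative in \<^const>\<open>C_k\<close> is chosen by \<^const>\<open>frechet_derivative\<close>. This rule and the next one trade it for an
  explicit derivative.\<close>
lemma C_k_SucI:
  assumes "\<And>x. (\<phi> has_derivative D x) (at x)" "\<And>i. C_k k (\<lambda>x. D x (axis i 1))"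
  shows "C_k (Suc k) \<phi>"
proof -
  have "partial_deriv i \<phi> = (\<lambda>x. D x (axis i 1))" for i
    using partial_deriv_eq[OF assms(1)] by auto
  then show ?thesis using assms
    by (auto simp: differentiable_on_def differentiable_def intro: has_derivative_at_withinI)
qed

lemma C_k_SucE:
  assumes "C_k (Suc k) \<phi>"
  shows "(\<phi> has_derivative frechet_derivative \<phi> (at x)) (at x)"
    and "C_k k (\<lambda>x. frechet_derivative \<phi> (at x) (axis i 1))"
  using assms by (auto simp: differentiable_on_def frechet_derivative_works partial_deriv_def[abs_def])

lemma C_k_const: "C_k k (\<lambda>x. c)"
proof (induction k arbitrary: c)
  case (Suc k)
  show ?case by (rule C_k_SucI[where D = "\<lambda>_ _. 0"]) (use Suc in auto)
qed simp

lemma C_k_nth: "C_k k (\<lambda>x. x $ i)"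
proof (cases k)
  case 0
  then show ?thesis by (simp add: continuous_on_component)
next
  case (Suc j)
  then show ?thesis
    by (auto intro!: C_k_SucI[where D = "\<lambda>_ h. h $ i"] C_k_const 
        bounded_linear_imp_has_derivative bounded_linear_vec_nth simp del: C_k.simps)
qed

lemma C_k_add: "C_k k f \<Longrightarrow> C_k k g \<Longrightarrow> C_k k (\<lambda>x. f x + g x)"
proof (induction k arbitrary: f g)
  case 0
  then show ?case by (simp add: continuous_on_add)
next
  case (Suc k)
  note f = C_k_SucE[OF Suc.prems(1)] and g = C_k_SucE[OF Suc.prems(2)]
  show ?case
    by (rule C_k_SucI[OF has_derivative_add[OF f(1) g(1)]]) (intro Suc.IH f g)
qed

lemma C_k_mult: "C_k k f \<Longrightarrow> C_k k g \<Longrightarrow> C_k k (\<lambda>x. f x * g x)"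
proof (induction k arbitrary: f g)
  case 0
  then show ?case by (simp add: continuous_on_mult)
next
  case (Suc k)
  note f = C_k_SucE[OF Suc.prems(1)] and g = C_k_SucE[OF Suc.prems(2)]
  show ?case
    by (rule C_k_SucI[OF has_derivative_mult[OF f(1) g(1)]])
       (intro Suc.IH C_k_add f g C_k_SucD[OF Suc.prems(1)] C_k_SucD[OF Suc.prems(2)])
qed

lemma C_k_sum: "(\<And>i. i \<in> I \<Longrightarrow> C_k k (f i)) \<Longrightarrow> C_k k (\<lambda>x. \<Sum>i\<in>I. f i x)"
  by (induction I rule: infinite_finite_induct) (auto intro: C_k_const C_k_add)

lemma C_k_compose:
  assumes "Ck_on k UNIV F" "C_k k g"
  shows "C_k k (\<lambda>x. F (g x))"
  using assms
proof (induction k arbitrary: F)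
  case 0
  then show ?case by (auto intro: continuous_on_compose2)
next
  case (Suc k)
  then obtain F' where F': "\<forall>x. (F has_real_derivative F' x) (at x)" "Ck_on k UNIV F'" by auto
  note g = C_k_SucE[OF Suc.prems(2)]
  have "((\<lambda>x. F (g x)) has_derivative (\<lambda>h. F' (g x) * frechet_derivative g (at x) h)) (at x)" for x
    using DERIV_compose_FDERIV[OF F'(1)[rule_format] g(1)] by (simp add: mult.commute)
  then show ?case
    by (rule C_k_SucI) (rule C_k_mult[OF Suc.IH[OF F'(2) C_k_SucD[OF Suc.prems(2)]] g(2)])
qed

lemma power2_norm_vec: "(norm x)\<^sup>2 = (\<Sum>i\<in>UNIV. x $ i * x $ i)" for x :: "real ^ 'n"
  by (simp add: power2_norm_eq_inner inner_vec_def)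

lemma C_k_norm_power2: "C_k k (\<lambda>x. (norm x)\<^sup>2)"
  unfolding power2_norm_vec by (intro C_k_sum C_k_mult C_k_nth)

text \<open>The fields \<open>Q(|x|\<^sup>2) x\<close> are the radial test fields. They are smooth also at the origin because they are
  built from \<open>|x|\<^sup>2\<close>, and the second statement is what their divergence is summed from.\<close>
lemma radial_test_field:
  fixes Q Q' :: "real \<Rightarrow> real" and i :: "'n::finite"
  assumes Q: "\<And>k. Ck_on k UNIV Q" "\<And>t. t > r \<Longrightarrow> Q t = 0"
    and Q': "\<And>t. (Q has_real_derivative Q' t) (at t)"
  shows "(\<lambda>x::real^'n. x $ i * Q ((norm x)\<^sup>2)) \<in> test_functions"
    and "partial_deriv i (\<lambda>x::real^'n. x $ i * Q ((norm x)\<^sup>2)) x =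
      Q ((norm x)\<^sup>2) + 2 * (x $ i)\<^sup>2 * Q' ((norm x)\<^sup>2)"
proof -
  have "norm x \<le> sqrt \<bar>r\<bar>" if "Q ((norm x)\<^sup>2) \<noteq> 0" for x :: "real^'n"
  proof -
    have "(norm x)\<^sup>2 \<le> \<bar>r\<bar>" using Q(2)[of "(norm x)\<^sup>2"] that by force
    then show ?thesis by (simp add: real_le_rsqrt)
  qed
  then have "{x::real^'n. x $ i * Q ((norm x)\<^sup>2) \<noteq> 0} \<subseteq> cball 0 (sqrt \<bar>r\<bar>)"
    by auto
  then have "bounded {x::real^'n. x $ i * Q ((norm x)\<^sup>2) \<noteq> 0}"
    using bounded_cball bounded_subset by blast
  moreover have "C_k k (\<lambda>x::real^'n. x $ i * Q ((norm x)\<^sup>2))" for k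
    by (rule C_k_mult[OF C_k_nth C_k_compose[OF Q(1) C_k_norm_power2]])
  ultimately show "(\<lambda>x::real^'n. x $ i * Q ((norm x)\<^sup>2)) \<in> test_functions"
    unfolding test_functions_def by (simp add: compact_closure)
  have 1: "((\<lambda>x::real^'n. (norm x)\<^sup>2) has_derivative (\<lambda>h. 2 * (x \<bullet> h))) (at x)"
    unfolding power2_norm_eq_inner
    by (auto intro!: derivative_eq_intros simp: inner_commute)
  have "((\<lambda>x::real^'n. x $ i * Q ((norm x)\<^sup>2)) has_derivative
      (\<lambda>h. x $ i * (2 * (x \<bullet> h) * Q' ((norm x)\<^sup>2)) + h $ i * Q ((norm x)\<^sup>2))) (at x)"
    by (intro has_derivative_mult bounded_linear_imp_has_derivative bounded_linear_vec_nth
        DERIV_compose_FDERIV[OF Q' 1])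
  from partial_deriv_eq[OF this, of i]
  show "partial_deriv i (\<lambda>x::real^'n. x $ i * Q ((norm x)\<^sup>2)) x =
      Q ((norm x)\<^sup>2) + 2 * (x $ i)\<^sup>2 * Q' ((norm x)\<^sup>2)"
    by (simp add: power2_eq_square inner_axis)
qed

section \<open>Radial vector fields in the weak formulation\<close>

text \<open>The antiderivative is minus the integral over the right half line; the mean value zero makes it vanish to the
  left of the support as well. The integral formula is kept for a later application of Fubini.\<close>
lemma compactly_supported_antiderivative:
  fixes \<kappa> :: "real \<Rightarrow> real"
  assumes cont: "continuous_on UNIV \<kappa>"
    and supp: "\<And>t. t \<notin> {a..b} \<Longrightarrow> \<kappa> t = 0"
    and mean: "(\<integral>t. \<kappa> t \<partial>lborel) = 0"
  obtains Z where "\<And>t. (Z has_real_derivative \<kappa> t) (at t)"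
    and "\<And>t. t \<notin> {a..b} \<Longrightarrow> Z t = 0"
    and "\<And>r. (\<integral>t. \<kappa> t * indicator {r<..} t \<partial>lborel) = - Z r"
proof
  define Z where "Z r = - (\<integral>t. \<kappa> t * indicator {r<..} t \<partial>lborel)" for r
  then show "(\<integral>t. \<kappa> t * indicator {r<..} t \<partial>lborel) = - Z r" for r by simp
  have "\<exists>F. \<forall>x::real. - \<infinity> < ereal x \<longrightarrow> ereal x < \<infinity> \<longrightarrow> (F has_vector_derivative \<kappa> x) (at x)"
    by (rule einterval_antiderivative) (use cont in \<open>auto simp: continuous_on_eq_continuous_at\<close>)
  then obtain F where F: "\<And>x. (F has_real_derivative \<kappa> x) (at x)"
    by (auto simp: has_real_derivative_iff_has_vector_derivative)
  have isCont: "isCont \<kappa> x" for x using cont by (simp add: continuous_on_eq_continuous_at)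
  have [measurable]: "\<kappa> \<in> borel_measurable borel"
    using borel_measurable_continuous_onI[OF cont] .
  have Z: "Z r = F r - F R" if "r \<le> R" "b \<le> R" for r R
  proof -
    have "(\<integral>t. \<kappa> t * indicator {r<..} t \<partial>lborel) = (\<integral>t. \<kappa> t * indicator {r..R} t \<partial>lborel)"
    proof (rule integral_cong_AE)
      show "AE t in lborel. \<kappa> t * indicator {r<..} t = \<kappa> t * indicator {r..R} t"
        using AE_lborel_singleton[of r] 
        by eventually_elim (use supp that in \<open>auto simp: indicator_def\<close>)
    qed measurable
    also have "\<dots> = F R - F r"
      by (rule integral_FTC_Icc_real[OF that(1) F isCont])
    finally show ?thesis by (simp add: Z_def)
  qed
  show "(Z has_real_derivative \<kappa> t) (at t)" for t
  proof -
    define R where "R = max b (t + 1)"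
    have "((\<lambda>r. F r - F R) has_real_derivative \<kappa> t) (at t)"
      using F[of t] by (auto intro!: derivative_eq_intros)
    then show ?thesis
      by (rule has_field_derivative_transform_within_open[of _ _ _ "{..<R}"])
         (use Z[of _ R] in \<open>auto simp: R_def\<close>)
  qed
  show "Z t = 0" if "t \<notin> {a..b}" for t
  proof (cases "t < a")
    case True
    then have "\<kappa> s * indicator {t<..} s = \<kappa> s" for s
      using supp[of s] by (auto simp: indicator_def)
    then have "(\<integral>s. \<kappa> s * indicator {t<..} s \<partial>lborel) = (\<integral>s. \<kappa> s \<partial>lborel)"
      by (intro Bochner_Integration.integral_cong refl)
    then show ?thesis using mean by (simp add: Z_def)
  next
    case False
    then have "(\<lambda>s. \<kappa> s * indicator {t<..} s) = (\<lambda>s. 0)"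
      using supp that by (auto simp: indicator_def fun_eq_iff)
    then show ?thesis by (simp add: Z_def)
  qed
qed

text \<open>The field \<open>x \<mapsto> |x|\<^sup>-\<^sup>N Z(|x|\<^sup>2) x\<close> has divergence \<open>2 |x|\<^sup>2\<^sup>-\<^sup>N Z'(|x|\<^sup>2)\<close>; its profile is smooth on
  the whole line since \<open>Z\<close> vanishes near and below the origin.\<close>
lemma radial_field_profile:
  fixes \<kappa> Z :: "real \<Rightarrow> real" and m :: real
  assumes \<kappa>: "\<And>k. Ck_on k UNIV \<kappa>"
    and Z: "\<And>t. (Z has_real_derivative \<kappa> t) (at t)" "\<And>t. t \<notin> {a..b} \<Longrightarrow> Z t = 0" and "0 < a"
    and \<kappa>0: "\<And>t. t \<notin> {a..b} \<Longrightarrow> \<kappa> t = 0"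
  defines "Q \<equiv> \<lambda>t. t powr (- m / 2) * Z t"
  defines "Q' \<equiv> \<lambda>t. if t > 0 then - m / 2 * t powr (- m / 2 - 1) * Z t + t powr (- m / 2) * \<kappa> t else 0"
  shows "Ck_on k UNIV Q"
    and "(Q has_real_derivative Q' t) (at t)"
    and "t \<ge> 0 \<Longrightarrow> m * Q t + 2 * t * Q' t = 2 * t powr (1 - m / 2) * \<kappa> t"
proof -
  have Z_smooth: "Ck_on k S Z" for k S
    using Ck_on_subset[OF Ck_on_SucD[OF Ck_on_SucI[of UNIV Z \<kappa>, OF Z(1) \<kappa>]]] by blast
  have "Ck_on k {0<..} Q"
    unfolding Q_def by (intro Ck_on_mult Ck_on_powr Z_smooth)
  moreover have "Ck_on k {..<a} Q"
    by (rule Ck_on_cong[OF _ _ Ck_on_const[of _ _ 0]]) (auto simp: Q_def Z(2))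
  ultimately have "Ck_on k ({0<..} \<union> {..<a}) Q"
    by (intro Ck_on_Un) auto
  moreover have "{0<..} \<union> {..<a} = (UNIV :: real set)" using \<open>0 < a\<close> by auto
  ultimately show "Ck_on k UNIV Q" by simp
  show "(Q has_real_derivative Q' t) (at t)"
  proof (cases "t > 0")
    case True
    then show ?thesis unfolding Q_def Q'_def using Z(1)[of t]
      by (auto intro!: derivative_eq_intros)
  next
    case False
    have "((\<lambda>_. 0) has_real_derivative Q' t) (at t)"
      using False by (simp add: Q'_def)
    then show ?thesis
      by (rule has_field_derivative_transform_within_open[of _ _ _ "{..<a}"])
         (use False \<open>0 < a\<close> in \<open>auto simp: Q_def Z(2)\<close>)
  qed
  show "m * Q t + 2 * t * Q' t = 2 * t powr (1 - m / 2) * \<kappa> t" if "t \<ge> 0"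
  proof (cases "t = 0")
    case True
    then show ?thesis by (simp add: Q_def Q'_def)
  next
    case False
    with that have t: "t > 0" by simp
    have 1: "t * t powr (- m / 2 - 1) = t powr (- m / 2)"
      using t by (simp add: powr_diff)
    have 2: "t * t powr (- m / 2) = t powr (1 - m / 2)"
      using t powr_mult_base[of t "- m / 2"] by simp
    have "m * Q t + 2 * t * Q' t = m * (t powr (- m / 2) * Z t)
        - m * (t * t powr (- m / 2 - 1)) * Z t + 2 * (t * t powr (- m / 2)) * \<kappa> t"
      using t by (simp add: Q_def Q'_def algebra_simps)
    also have "\<dots> = 2 * t powr (1 - m / 2) * \<kappa> t"
      unfolding 1 2 by simp
    finally show ?thesis .
  qed
qed

text \<open>Here \<open>\<phi> f\<close> is dominated by \<open>\<phi>\<^sup>2 + |f|\<^sup>2\<close>.\<close>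
lemma integrable_bounded_support_L2:
  fixes \<phi> :: "real ^ 'n::finite \<Rightarrow> real" and f :: "real ^ 'n \<Rightarrow> 'b::euclidean_space"
  assumes cont: "continuous_on UNIV \<phi>" and supp: "\<And>x. norm x > r \<Longrightarrow> \<phi> x = 0"
    and f: "f \<in> L2"
  shows "integrable lebesgue (\<lambda>x. \<phi> x *\<^sub>R f x)"
proof -
  have [measurable]: "\<phi> \<in> borel_measurable borel" "\<phi> \<in> borel_measurable lebesgue"
    using borel_measurable_continuous_onI[OF cont] by (auto intro: measurable_completion)
  have [measurable]: "f \<in> borel_measurable lebesgue" and f2: "integrable lebesgue (\<lambda>x. (norm (f x))\<^sup>2)"
    using f by (auto simp: L2_def)
  have "compact (\<phi> ` cball 0 r)"
    by (rule compact_continuous_image[OF continuous_on_subset[OF cont]]) auto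
  then obtain M where "\<forall>y\<in>\<phi> ` cball 0 r. norm y \<le> M"
    using compact_imp_bounded bounded_iff by metis
  then have M: "\<bar>\<phi> x\<bar> \<le> M" if "norm x \<le> r" for x
    using that by auto
  have "integrable lborel (\<lambda>x. (M\<^sup>2) * indicator (cball (0::real^'n) r) x)"
    using emeasure_lborel_cball_finite[of "0::real^'n" r] by (intro integrable_mult_right) (simp add: less_top)
  then have 1: "integrable lebesgue (\<lambda>x. (M\<^sup>2) * indicator (cball (0::real^'n) r) x)"
    by (subst integrable_completion) (auto)
  show ?thesis
  proof (rule Bochner_Integration.integrable_bound[OF Bochner_Integration.integrable_add[OF 1 f2]])
    show "AE x in lebesgue. norm (\<phi> x *\<^sub>R f x) \<le>
        norm (M\<^sup>2 * indicator (cball (0::real^'n) r) x + (norm (f x))\<^sup>2)"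
    proof (rule AE_I2)
      fix x :: "real^'n"
      have "norm (\<phi> x *\<^sub>R f x) \<le> (\<phi> x)\<^sup>2 + (norm (f x))\<^sup>2"
      proof -
        have "0 \<le> \<bar>\<phi> x\<bar> * norm (f x)" by simp
        then show ?thesis
          using sum_squares_bound[of "\<bar>\<phi> x\<bar>" "norm (f x)"]
          unfolding norm_scaleR power2_abs mult.assoc by linarith
      qed
      also have "(\<phi> x)\<^sup>2 \<le> M\<^sup>2 * indicator (cball (0::real^'n) r) x"
        using M[of x] supp[of x] power_mono[of "\<bar>\<phi> x\<bar>" M 2] by (cases "norm x \<le> r") auto
      finally show "norm (\<phi> x *\<^sub>R f x) \<le> norm (M\<^sup>2 * indicator (cball (0::real^'n) r) x + (norm (f x))\<^sup>2)"
        by simp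
    qed
  qed measurable
qed

lemma L2_component:
  fixes G :: "real ^ 'n::finite \<Rightarrow> complex ^ 'm::finite"
  assumes "G \<in> L2"
  shows "(\<lambda>x. G x $ i) \<in> L2"
proof -
  have [measurable]: "G \<in> borel_measurable lebesgue" and G2: "integrable lebesgue (\<lambda>x. (norm (G x))\<^sup>2)"
    using assms by (auto simp: L2_def)
  have [measurable]: "(\<lambda>x. G x $ i) \<in> borel_measurable lebesgue"
    by (rule borel_measurable_continuous_on[where f = "\<lambda>v. v $ i"]) (auto intro!: continuous_intros)
  have "integrable lebesgue (\<lambda>x. (norm (G x $ i))\<^sup>2)"
    by (rule Bochner_Integration.integrable_bound[OF G2])
       (auto intro!: power_mono Finite_Cartesian_Product.norm_nth_le)
  then show ?thesis by (simp add: L2_def)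
qed

text \<open>The weak formulation, tested with the components of the field \<open>|x|\<^sup>-\<^sup>N Z(|x|\<^sup>2) x\<close> and summed over them. The
  factor \<open>|x|\<^sup>-\<^sup>N\<close> is the one for which the divergence involves only the derivative \<open>\<kappa>\<close> of \<open>Z\<close>.\<close>
lemma weak_gradient_radial_field:
  fixes f :: "real ^ 'n::finite \<Rightarrow> complex" and G :: "real ^ 'n \<Rightarrow> complex ^ 'n"
  assumes fG: "f \<in> L2" "G \<in> L2" "is_weak_gradient f G"
    and \<kappa>: "\<And>k. Ck_on k UNIV \<kappa>" "\<And>t. t \<notin> {a..b} \<Longrightarrow> \<kappa> t = 0" and "0 < a"
    and Z: "\<And>t. (Z has_real_derivative \<kappa> t) (at t)" "\<And>t. t \<notin> {a..b} \<Longrightarrow> Z t = 0"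
  defines "m \<equiv> real CARD('n)"
  shows "(\<integral>x. (2 * (norm x)\<^sup>2 powr (1 - m / 2) * \<kappa> ((norm x)\<^sup>2)) *\<^sub>R f x \<partial>lebesgue)
    = - (\<integral>x. ((norm x)\<^sup>2 powr (- m / 2) * Z ((norm x)\<^sup>2)) *\<^sub>R (\<Sum>i\<in>UNIV. x $ i *\<^sub>R G x $ i) \<partial>lebesgue)"
proof -
  define Q where "Q = (\<lambda>t. t powr (- m / 2) * Z t)"
  define Q' where "Q' = (\<lambda>t. if t > 0 then - m / 2 * t powr (- m / 2 - 1) * Z t + t powr (- m / 2) * \<kappa> t else 0)"
  have prof: "Ck_on k UNIV Q" "(Q has_real_derivative Q' t) (at t)"
    for k t
    unfolding Q_def Q'_def
    by (rule radial_field_profile[where \<kappa> = \<kappa> and Z = Z and a = a and b = b];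
        (assumption | fact))+
  have div: "m * Q t + 2 * t * Q' t = 2 * t powr (1 - m / 2) * \<kappa> t" if "t \<ge> 0" for t
    unfolding Q_def Q'_def
    by (rule radial_field_profile(3)[where \<kappa> = \<kappa> and Z = Z and a = a and b = b]; fact)
  have Q0: "Q t = 0" if "t > b" for t using Z(2)[of t] that by (simp add: Q_def)
  have Q'0: "Q' t = 0" if "t > b" for t using Z(2)[of t] \<kappa>(2)[of t] that by (simp add: Q'_def)
  have contQ: "continuous_on UNIV Q" using prof(1)[of 0] by simp
  have contQ': "continuous_on UNIV Q'"
  proof -
    obtain q where q: "\<forall>t. (Q has_real_derivative q t) (at t)" "continuous_on UNIV q"
      using prof(1)[of "Suc 0"] by auto
    then have "q = Q'" using DERIV_unique prof(2) by blast
    with q show ?thesis by simp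
  qed
  have big: "(norm x)\<^sup>2 > b" if "norm x > sqrt \<bar>b\<bar>" for x :: "real^'n"
    using that real_sqrt_less_iff[of "\<bar>b\<bar>" "(norm x)\<^sup>2"] by simp
  define \<phi> where "\<phi> = (\<lambda>i (x::real^'n). x $ i * Q ((norm x)\<^sup>2))"
  define \<psi> where "\<psi> = (\<lambda>i (x::real^'n). Q ((norm x)\<^sup>2) + 2 * (x $ i)\<^sup>2 * Q' ((norm x)\<^sup>2))"
  have test: "\<phi> i \<in> test_functions" for i
    unfolding \<phi>_def by (rule radial_test_field(1)[OF prof(1) _ prof(2), of b]) (rule Q0)
  have pd: "partial_deriv i (\<phi> i) = \<psi> i" for i
    unfolding \<phi>_def \<psi>_def
    by (intro ext, rule radial_test_field(2)[OF prof(1) _ prof(2), of b]) (rule Q0)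
  have weak: "(\<integral>x. \<psi> i x *\<^sub>R f x \<partial>lebesgue) = - (\<integral>x. \<phi> i x *\<^sub>R (G x $ i) \<partial>lebesgue)" for i
    using fG(3) test[of i] unfolding is_weak_gradient_def pd[symmetric] by blast
  have cQ: "continuous_on UNIV (\<lambda>x::real^'n. Q ((norm x)\<^sup>2))"
    "continuous_on UNIV (\<lambda>x::real^'n. Q' ((norm x)\<^sup>2))"
    by (auto intro!: continuous_on_compose2[OF contQ] continuous_on_compose2[OF contQ'] continuous_intros)
  have int\<psi>: "integrable lebesgue (\<lambda>x. \<psi> i x *\<^sub>R f x)" for i
    by (rule integrable_bounded_support_L2[OF _ _ fG(1), of _ "sqrt \<bar>b\<bar>"])
       (auto simp: \<psi>_def Q0 Q'0 big intro!: continuous_intros cQ)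
  have int\<phi>: "integrable lebesgue (\<lambda>x. \<phi> i x *\<^sub>R (G x $ i))" for i
    by (rule integrable_bounded_support_L2[OF _ _ L2_component[OF fG(2)], of _ "sqrt \<bar>b\<bar>"])
       (auto simp: \<phi>_def Q0 big intro!: continuous_intros cQ)
  have "(\<integral>x. (2 * (norm x)\<^sup>2 powr (1 - m / 2) * \<kappa> ((norm x)\<^sup>2)) *\<^sub>R f x \<partial>lebesgue)
      = (\<integral>x. (\<Sum>i\<in>UNIV. \<psi> i x *\<^sub>R f x) \<partial>lebesgue)"
  proof (rule Bochner_Integration.integral_cong[OF refl])
    fix x :: "real^'n"
    have "(\<Sum>i\<in>UNIV. \<psi> i x) = m * Q ((norm x)\<^sup>2) + 2 * (\<Sum>i\<in>UNIV. x $ i * x $ i) * Q' ((norm x)\<^sup>2)"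
      by (simp add: \<psi>_def sum.distrib m_def sum_distrib_left sum_distrib_right power2_eq_square)
    also have "\<dots> = 2 * (norm x)\<^sup>2 powr (1 - m / 2) * \<kappa> ((norm x)\<^sup>2)"
      using div[OF zero_le_power2, of "norm x"] unfolding power2_norm_vec .
    finally show "(2 * (norm x)\<^sup>2 powr (1 - m / 2) * \<kappa> ((norm x)\<^sup>2)) *\<^sub>R f x = (\<Sum>i\<in>UNIV. \<psi> i x *\<^sub>R f x)"
      by (simp add: scaleR_sum_left[symmetric])
  qed
  also have "\<dots> = (\<Sum>i\<in>UNIV. \<integral>x. \<psi> i x *\<^sub>R f x \<partial>lebesgue)"
    by (rule Bochner_Integration.integral_sum) (rule int\<psi>)
  also have "\<dots> = - (\<Sum>i\<in>UNIV. \<integral>x. \<phi> i x *\<^sub>R (G x $ i) \<partial>lebesgue)"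
    unfolding weak by (simp add: sum_negf)
  also have "(\<Sum>i\<in>UNIV. \<integral>x. \<phi> i x *\<^sub>R (G x $ i) \<partial>lebesgue) = (\<integral>x. (\<Sum>i\<in>UNIV. \<phi> i x *\<^sub>R (G x $ i)) \<partial>lebesgue)"
    by (rule Bochner_Integration.integral_sum[symmetric]) (rule int\<phi>)
  also have "\<dots> = (\<integral>x. ((norm x)\<^sup>2 powr (- m / 2) * Z ((norm x)\<^sup>2)) *\<^sub>R (\<Sum>i\<in>UNIV. x $ i *\<^sub>R G x $ i) \<partial>lebesgue)"
    by (rule Bochner_Integration.integral_cong[OF refl])
       (simp add: \<phi>_def Q_def scaleR_sum_right mult.commute)
  finally show ?thesis .
qed

section \<open>Integration of radial functions\<close>

lemma emeasure_cball_eq_ball: 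
  fixes c :: "'a::euclidean_space"
  assumes "r \<ge> 0"
  shows "emeasure lborel (cball c r) = ennreal (r ^ DIM('a) * measure lborel (ball (0::'a) 1))"
proof -
  have "emeasure lborel (cball c r) = ennreal (measure lborel (cball c r))"
    using emeasure_lborel_cball_finite[of c r] by (intro emeasure_eq_ennreal_measure) auto
  then show ?thesis using content_ball_conv_unit_ball[OF assms, of c] content_cball_conv_ball[of c r] by simp
qed

text \<open>Polar coordinates for radial integrands. Both measures agree on half lines, since the ball of radius \<open>\<surd>a\<close> has
  volume proportional to \<open>a\<^sup>N\<^sup>/\<^sup>2\<close>.\<close>
lemma distr_norm_power2:
  fixes K :: real
  defines "K \<equiv> measure lborel (ball (0::'a::euclidean_space) 1) * (DIM('a) / 2)"
  shows "distr lborel borel (\<lambda>x::'a. (norm x)\<^sup>2)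
    = density lborel (\<lambda>t. ennreal (indicator {0<..} t * (K * t powr (DIM('a) / 2 - 1))))"
    (is "?M = ?D")
proof (rule measure_eqI_generator_eq_countable)
  let ?E = "range (\<lambda>a::real. {..a})"
  let ?L = "measure lborel (ball (0::'a) 1)"
  show "Int_stable ?E" by (auto simp: Int_stable_def)
  show "?E \<subseteq> Pow UNIV" by simp
  show "sets ?M = sigma_sets UNIV ?E" "sets ?D = sigma_sets UNIV ?E"
    by (simp_all, (subst borel_eq_atMost, simp)+)
  show "range (\<lambda>n::nat. {..real n}) \<subseteq> ?E" "countable (range (\<lambda>n::nat. {..real n}))" by auto
  show "\<Union>(range (\<lambda>n::nat. {..real n})) = UNIV" using real_arch_simple by auto
  have M: "emeasure ?M {..a} = (if a < 0 then 0 else ennreal (?L * a powr (DIM('a) / 2)))" for a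
  proof -
    have "emeasure ?M {..a} = emeasure lborel {x::'a. (norm x)\<^sup>2 \<le> a}"
      by (subst emeasure_distr) (auto simp: vimage_def)
    also have "{x::'a. (norm x)\<^sup>2 \<le> a} = (if a < 0 then {} else cball 0 (sqrt a))"
    proof (cases "a < 0")
      case True
      have "\<not> (norm x)\<^sup>2 \<le> a" for x :: 'a
        using True zero_le_power2[of "norm x"] by linarith
      then show ?thesis using True by simp
    next
      case False
      have "(norm x)\<^sup>2 \<le> a \<longleftrightarrow> norm x \<le> sqrt a" for x :: 'a
        using real_sqrt_le_iff[of "(norm x)\<^sup>2" a] by simp
      then show ?thesis using False by (simp only: if_False cball_def dist_0_norm)
    qed
    also have "emeasure lborel \<dots> = (if a < 0 then 0 else ennreal (?L * a powr (DIM('a) / 2)))"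
    proof (cases "a < 0")
      case False
      have "sqrt a ^ DIM('a) = sqrt a powr real DIM('a)"
        using False by (subst powr_realpow') auto
      also have "\<dots> = (a powr (1 / 2)) powr real DIM('a)"
        using False by (simp only: powr_half_sqrt not_less)
      finally have "sqrt a ^ DIM('a) = a powr (DIM('a) / 2)"
        by (simp only: powr_powr) simp
      then show ?thesis using False by (simp add: emeasure_cball_eq_ball mult.commute)
    qed simp
    finally show ?thesis .
  qed
  show "\<And>A. A \<in> range (\<lambda>n::nat. {..real n}) \<Longrightarrow> emeasure ?M A \<noteq> \<infinity>"
    by (auto simp: M)
  have D: "emeasure ?D {..a} = (if a < 0 then 0 else ennreal (?L * a powr (DIM('a) / 2)))" for a
  proof (cases "a < 0")
    case True
    then show ?thesis
      by (subst emeasure_density) (auto intro!: nn_integral_0_iff_AE[THEN iffD2] AE_I2 simp: indicator_def)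
  next
    case False
    have "((\<lambda>t. K * t powr (DIM('a) / 2 - 1)) has_integral (?L * a powr (DIM('a) / 2) - ?L * 0 powr (DIM('a) / 2))) {0..a}"
    proof (rule fundamental_theorem_of_calculus_interior)
      show "continuous_on {0..a} (\<lambda>t. ?L * t powr (DIM('a) / 2))"
        by (auto intro!: continuous_intros continuous_on_powr')
      show "((\<lambda>t. ?L * t powr (DIM('a) / 2)) has_vector_derivative K * t powr (DIM('a) / 2 - 1)) (at t)"
        if "t \<in> {0<..<a}" for t
        unfolding has_real_derivative_iff_has_vector_derivative[symmetric] K_def
        using that by (auto intro!: derivative_eq_intros)
    qed (use False in auto)
    then have "(\<integral>\<^sup>+t. ennreal (K * t powr (DIM('a) / 2 - 1)) * indicator {0..a} t \<partial>lborel)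
        = ennreal (?L * a powr (DIM('a) / 2))"
      by (subst nn_integral_has_integral_lebesgue') (auto simp: K_def)
    moreover have "emeasure ?D {..a} = (\<integral>\<^sup>+t. ennreal (K * t powr (DIM('a) / 2 - 1)) * indicator {0..a} t \<partial>lborel)"
      by (subst emeasure_density)
        (auto intro!: nn_integral_cong_AE eventually_mono[OF AE_lborel_singleton[of 0]] simp: indicator_def)
    ultimately show ?thesis using False by simp
  qed
  show "\<And>X. X \<in> ?E \<Longrightarrow> emeasure ?M X = emeasure ?D X"
    using M D by auto
qed

definition sphere_area :: "'a::euclidean_space itself \<Rightarrow> real" where
  "sphere_area _ = real DIM('a) * measure lborel (ball (0::'a) 1)"

lemma sphere_area_pos: "sphere_area TYPE('a::euclidean_space) > 0"
  using content_ball_pos[of 1 "0::'a"] by (simp add: sphere_area_def)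

text \<open>The image of Lebesgue measure under \<open>|x|\<^sup>2\<close>. The factor \<open>1/2\<close> and the exponent come from \<open>t = r\<^sup>2\<close> in
  \<open>S r\<^sup>N\<^sup>-\<^sup>1 dr\<close>.\<close>
definition radial_density :: "'a::euclidean_space itself \<Rightarrow> real \<Rightarrow> real" where
  "radial_density a t = indicator {0<..} t * (sphere_area a / 2 * t powr (DIM('a) / 2 - 1))"

lemma radial_density_nonneg: "radial_density TYPE('a::euclidean_space) t \<ge> 0"
  using sphere_area_pos[where 'a='a] by (simp add: radial_density_def)

lemma radial_density_measurable [measurable]: "radial_density a \<in> borel_measurable borel"
  unfolding radial_density_def[abs_def] by measurable

lemma distr_norm_power2_radial_density:
  "distr lborel borel (\<lambda>x::'a::euclidean_space. (norm x)\<^sup>2)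
    = density lborel (\<lambda>t. ennreal (radial_density TYPE('a) t))"
  using distr_norm_power2[where 'a='a] by (simp add: radial_density_def sphere_area_def mult_ac)

lemma nn_integral_norm_power2:
  assumes [measurable]: "h \<in> borel_measurable borel"
  shows "(\<integral>\<^sup>+x. h ((norm x)\<^sup>2) \<partial>(lborel :: 'a::euclidean_space measure))
    = (\<integral>\<^sup>+t. ennreal (radial_density TYPE('a) t) * h t \<partial>lborel)"
proof -
  have "(\<integral>\<^sup>+x. h ((norm x)\<^sup>2) \<partial>(lborel :: 'a measure)) = integral\<^sup>N (distr lborel borel (\<lambda>x::'a. (norm x)\<^sup>2)) h"
    by (subst nn_integral_distr) auto
  then show ?thesis
    unfolding distr_norm_power2_radial_density by (subst (asm) nn_integral_density) auto
qed

lemma integral_norm_power2: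
  fixes h :: "real \<Rightarrow> 'b::{banach, second_countable_topology}"
  assumes [measurable]: "h \<in> borel_measurable borel"
  shows "(\<integral>x. h ((norm x)\<^sup>2) \<partial>(lborel :: 'a::euclidean_space measure))
    = (\<integral>t. radial_density TYPE('a) t *\<^sub>R h t \<partial>lborel)"
proof -
  have "(\<integral>x. h ((norm x)\<^sup>2) \<partial>(lborel :: 'a measure)) = integral\<^sup>L (distr lborel borel (\<lambda>x::'a. (norm x)\<^sup>2)) h"
    by (subst integral_distr) auto
  then show ?thesis
    unfolding distr_norm_power2_radial_density
    by (subst (asm) integral_density) (auto simp: radial_density_nonneg)
qed

lemma integrable_norm_power2:
  fixes h :: "real \<Rightarrow> 'b::{banach, second_countable_topology}"
  assumes [measurable]: "h \<in> borel_measurable borel"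
  shows "integrable lborel (\<lambda>x::'a::euclidean_space. h ((norm x)\<^sup>2))
    \<longleftrightarrow> integrable lborel (\<lambda>t. radial_density TYPE('a) t *\<^sub>R h t)"
proof -
  have "integrable lborel (\<lambda>x::'a. h ((norm x)\<^sup>2))
    \<longleftrightarrow> integrable (distr lborel borel (\<lambda>x::'a. (norm x)\<^sup>2)) h"
    by (subst integrable_distr_eq) auto
  then show ?thesis
    unfolding distr_norm_power2_radial_density
    by (subst (asm) integrable_density) (auto simp: radial_density_nonneg)
qed

lemma AE_norm_power2:
  assumes "AE t in lborel. t > 0 \<longrightarrow> P t"
  shows "AE x in (lborel :: 'a::euclidean_space measure). P ((norm x)\<^sup>2)"
proof -
  have "AE t in density lborel (\<lambda>t. ennreal (radial_density TYPE('a) t)). P t"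
    using assms by (subst AE_density) (auto elim!: eventually_mono simp: radial_density_def indicator_def split: if_splits)
  then have "AE t in distr lborel borel (\<lambda>x::'a. (norm x)\<^sup>2). P t"
    by (subst distr_norm_power2_radial_density)
  then show ?thesis by (rule AE_distrD[rotated]) simp
qed

lemma AE_scaleR:
  fixes c :: real
  assumes "c \<noteq> 0" "AE x in (lborel :: 'a::euclidean_space measure). P x"
  shows "AE x in lborel. P (c *\<^sub>R x)"
proof -
  let ?T = "\<lambda>x::'a. 0 + c *\<^sub>R x"
  have "AE x in density (distr lborel borel ?T) (\<lambda>_. ennreal (\<bar>c\<bar> ^ DIM('a))). P x"
    using assms(2) lborel_affine[OF assms(1), of 0] by metis
  then have "AE x in distr lborel borel ?T. P x"
    by (subst (asm) AE_density) (use assms(1) in auto)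
  then show ?thesis using AE_distrD[of ?T lborel borel P] by simp
qed

lemma ex_borel_version:
  fixes f :: "'a::euclidean_space \<Rightarrow> 'b::euclidean_space"
  assumes "f \<in> borel_measurable lebesgue"
  obtains f' where "f' \<in> borel_measurable borel" "AE x in lborel. f x = f' x"
proof -
  have "\<exists>g. g \<in> borel_measurable lborel \<and> (AE x in lborel. f x \<bullet> b = g x)" for b
    using completion_ex_borel_measurable_real[of "\<lambda>x. f x \<bullet> b" lborel] assms by auto
  then obtain g where g: "\<And>b. g b \<in> borel_measurable lborel" "\<And>b. AE x in lborel. f x \<bullet> b = g b x"
    by metis
  show thesis
  proof
    show "(\<lambda>x. \<Sum>b\<in>Basis. g b x *\<^sub>R b) \<in> borel_measurable borel"
      using g(1) by simp
    have "AE x in lborel. \<forall>b\<in>Basis. f x \<bullet> b = g b x"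
      by (intro AE_finite_allI g) auto
    then show "AE x in lborel. f x = (\<Sum>b\<in>Basis. g b x *\<^sub>R b)"
      by eventually_elim (metis (no_types, lifting) euclidean_representation sum.cong)
  qed
qed

text \<open>In the hypothesis \<open>g\<close> is an arbitrary function, possibly not measurable. By Fubini the exceptional null set meets
  almost every ray from the origin in a null set; the restriction of \<open>f\<close> to one such ray, through the vector
  \<open>e\<close> below, is a Borel function of one variable, and it is a version of \<open>g\<close>.\<close>
lemma radial_borel_profile:
  fixes f :: "'a::euclidean_space \<Rightarrow> 'b::{second_countable_topology, t2_space}"
  assumes [measurable]: "f \<in> borel_measurable borel" and "AE x in lborel. f x = g (norm x)"
  obtains h where "h \<in> borel_measurable borel" "AE x in lborel. f x = h ((norm x)\<^sup>2)"
proof -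
  obtain N where N: "N \<in> null_sets lborel" "{x. f x \<noteq> g (norm x)} \<subseteq> N"
    using assms(2) by (auto elim: AE_E3 simp: eventually_ae_filter)
  then have [measurable]: "N \<in> sets borel" by auto
  have AEN: "AE x in lborel. x \<notin> N" using N(1) by (rule AE_not_in)
  have fg: "f x = g (norm x)" if "x \<notin> N" for x using N(2) that by auto
  \<comment> \<open>The section of \<open>N\<close> at radial parameter \<open>t\<close> is a dilate of a null set.\<close>
  have "AE x in lborel. AE t in lborel. t > 0 \<longrightarrow> sqrt t *\<^sub>R (x::'a) \<notin> N"
  proof (subst lborel_pair.AE_commute[symmetric])
    show "AE t in lborel. AE x in lborel. t > 0 \<longrightarrow> sqrt t *\<^sub>R (x::'a) \<notin> N"
    proof (rule AE_I2)
      fix t :: real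
      show "AE x in lborel. t > 0 \<longrightarrow> sqrt t *\<^sub>R (x::'a) \<notin> N"
        using AE_scaleR[OF _ AEN, of "sqrt t"] by (cases "t > 0") auto
    qed
  qed measurable
  then have "AE x in lborel. x \<noteq> 0 \<and> (AE t in lborel. t > 0 \<longrightarrow> sqrt t *\<^sub>R (x::'a) \<notin> N)"
    using AE_lborel_singleton[of "0::'a"] by eventually_elim auto
  moreover have "ae_filter (lborel :: 'a measure) \<noteq> bot"
    by (simp add: ae_filter_eq_bot_iff)
  ultimately obtain e :: 'a where e: "e \<noteq> 0" "AE t in lborel. t > 0 \<longrightarrow> sqrt t *\<^sub>R e \<notin> N"
    using eventually_happens by blast
  \<comment> \<open>Normalises the ray so that the point with parameter \<open>|x|\<^sup>2\<close> has norm \<open>|x|\<close>.\<close>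
  define c where "c = 1 / (norm e)\<^sup>2"
  have c: "c > 0" using e by (simp add: c_def)
  define h where "h t = f (sqrt (c * t) *\<^sub>R e)" for t
  have "AE t in lborel. 0 + c * t > 0 \<longrightarrow> sqrt (0 + c * t) *\<^sub>R e \<notin> N"
    by (rule AE_borel_affine) (use c e in auto)
  then have "AE t in lborel. t > 0 \<longrightarrow> sqrt (c * t) *\<^sub>R e \<notin> N"
    by eventually_elim (use c in auto)
  then have "AE x in (lborel :: 'a measure). sqrt (c * (norm x)\<^sup>2) *\<^sub>R e \<notin> N"
    by (rule AE_norm_power2)
  then have "AE x in lborel. f x = h ((norm x)\<^sup>2)"
    using AEN
  proof eventually_elim
    case (elim x)
    have "norm (sqrt (c * (norm x)\<^sup>2) *\<^sub>R e) = norm x"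
      using e(1) by (simp add: c_def real_sqrt_mult real_sqrt_divide)
    then show ?case using fg[OF elim(1)] fg[OF elim(2)] by (simp add: h_def)
  qed
  moreover have "h \<in> borel_measurable borel" unfolding h_def[abs_def] by measurable
  ultimately show thesis using that by blast
qed

section \<open>The du Bois-Reymond lemma on the half line\<close>

text \<open>The Borel sets on which \<open>g\<close> has integral zero form a Dynkin system containing the open intervals.\<close>
lemma AE_0_if_integrals_0:
  fixes g :: "real \<Rightarrow> 'b::{banach, second_countable_topology}"
  assumes g: "integrable lborel g"
    and 0: "\<And>a b. a < b \<Longrightarrow> (\<integral>t. indicator {a<..<b} t *\<^sub>R g t \<partial>lborel) = 0"
  shows "AE t in lborel. g t = 0"
proof (rule sigma_finite_measure.density_zero[OF lborel.sigma_finite_measure_axioms g])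
  fix A :: "real set" assume "A \<in> sets lborel"
  let ?G = "range (\<lambda>(a, b). {a<..<b::real})"
  have borel: "sets borel = sigma_sets UNIV ?G"
  proof -
    have "(\<lambda>(a, b). box a b) = (\<lambda>(a, b). {a<..<b::real})" by auto
    moreover have "sets borel = sigma_sets UNIV (range (\<lambda>(a, b). box a b :: real set))"
      by (subst borel_eq_box) simp
    ultimately show ?thesis by simp
  qed
  have int: "set_integrable lborel A g" if "A \<in> sets borel" for A
    using that g unfolding set_integrable_def by (intro integrable_mult_indicator) auto
  have basic: "(LINT t:{a<..<b}|lborel. g t) = 0" for a b
    using 0[of a b] by (cases "a < b") (auto simp: set_lebesgue_integral_def)
  have whole: "(\<integral>t. g t \<partial>lborel) = 0"
  proof (rule LIMSEQ_unique)
    show "(\<lambda>n. \<integral>t. indicator {- real n<..<real n} t *\<^sub>R g t \<partial>lborel) \<longlonglongrightarrow> (\<integral>t. g t \<partial>lborel)"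
    proof (rule integral_dominated_convergence)
      show "AE t in lborel. (\<lambda>n. indicator {- real n<..<real n} t *\<^sub>R g t) \<longlonglongrightarrow> g t"
      proof (rule AE_I2)
        fix t
        obtain n0 where "\<bar>t\<bar> < real n0" using reals_Archimedean2 by blast
        then have "\<forall>\<^sub>F n in sequentially. indicator {- real n<..<real n} t *\<^sub>R g t = g t"
          by (intro eventually_sequentiallyI[of n0]) (auto simp: indicator_def)
        then show "(\<lambda>n. indicator {- real n<..<real n} t *\<^sub>R g t) \<longlonglongrightarrow> g t"
          by (rule tendsto_eventually)
      qed
      show "integrable lborel (\<lambda>t. norm (g t))" using g by simp
    qed (use g in \<open>auto simp: indicator_def\<close>)
    show "(\<lambda>n. \<integral>t. indicator {- real n<..<real n} t *\<^sub>R g t \<partial>lborel) \<longlonglongrightarrow> 0"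
      using basic by (simp add: set_lebesgue_integral_def)
  qed
  have "Int_stable ?G"
  proof (rule Int_stableI_image, safe)
    fix a b c d :: real
    have "{a<..<b} \<inter> {c<..<d} = (\<lambda>(a, b). {a<..<b}) (max a c, min b d)" by auto
    then show "\<exists>k\<in>UNIV. {a<..<b} \<inter> {c<..<d} = (case k of (a, b) \<Rightarrow> {a<..<b})" by blast
  qed
  moreover have "?G \<subseteq> Pow UNIV" by simp
  moreover have "A \<in> sigma_sets UNIV ?G" using \<open>A \<in> sets lborel\<close> borel by simp
  ultimately show "(LINT t:A|lborel. g t) = 0"
  proof (induction rule: sigma_sets_induct_disjoint)
    case (basic A)
    then show ?case using \<open>\<And>a b. (LINT t:{a<..<b}|lborel. g t) = 0\<close> by auto
  next
    case empty
    then show ?case by (simp add: set_lebesgue_integral_def)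
  next
    case (compl A)
    then have A: "A \<in> sets borel" using borel by simp
    have "(LINT t:UNIV|lborel. g t) = (LINT t:A \<union> (UNIV - A)|lborel. g t)" by simp
    also have "\<dots> = (LINT t:A|lborel. g t) + (LINT t:UNIV - A|lborel. g t)"
      by (rule set_integral_Un) (use A int in auto)
    finally show ?case using compl whole by (simp add: set_lebesgue_integral_def)
  next
    case (union A)
    then have "A i \<in> sets lborel" for i using borel by auto
    then have "(LINT t:(\<Union>i. A i)|lborel. g t) = (\<Sum>i. (LINT t:A i|lborel. g t))"
      using union(1) by (intro lebesgue_integral_countable_add int) (auto simp: disjoint_family_on_def)
    then show ?case using union by simp
  qed
qed

text \<open>Corrected by a multiple of one fixed bump function, each of the smooth approximations to the indicator of an
  interval has mean value zero and may be used as \<open>\<kappa>\<close>. So \<open>q - c\<close> integrates to zero against them, where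
  \<open>c\<close> is the mean of \<open>q\<close> against the fixed bump, and in the limit over every interval.\<close>
lemma du_bois_reymond_halfline:
  fixes q :: "real \<Rightarrow> 'b::{banach, second_countable_topology}"
  assumes int: "\<And>a b. 0 < a \<Longrightarrow> set_integrable lborel {a..b} q"
    and weak: "\<And>\<kappa> a b. \<lbrakk>0 < a; \<And>k. Ck_on k UNIV \<kappa>; \<And>t. t \<notin> {a..b} \<Longrightarrow> \<kappa> t = 0;
      (\<integral>t. \<kappa> t \<partial>lborel) = 0\<rbrakk> \<Longrightarrow> (\<integral>t. \<kappa> t *\<^sub>R q t \<partial>lborel) = 0"
  obtains c where "AE t in lborel. t > 0 \<longrightarrow> q t = c"
proof -
  have meas [measurable]: "smooth_box n a b \<in> borel_measurable borel" for n a b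
    using Ck_on_smooth_box[of 0 UNIV n a b] by (intro borel_measurable_continuous_onI) simp
  have box_int: "integrable lborel (smooth_box n a b)" for n a b
  proof (rule Bochner_Integration.integrable_bound)
    show "integrable lborel (indicator {a..b} :: real \<Rightarrow> real)" by (simp add: integrable_indicator_iff emeasure_lborel_Icc_eq)
    show "AE t in lborel. norm (smooth_box n a b t) \<le> norm (indicator {a..b} t :: real)"
      using smooth_box_bounds smooth_box_eq_0 by (intro AE_I2) (auto simp: indicator_def)
  qed simp
  have boxq_int: "integrable lborel (\<lambda>t. smooth_box n a b t *\<^sub>R q t)" if "0 < a" for n a b
  proof (rule Bochner_Integration.integrable_bound)
    show I: "integrable lborel (\<lambda>t. indicator {a..b} t *\<^sub>R q t)"
      using int[OF that] by (simp add: set_integrable_def)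
    have "(\<lambda>t. smooth_box n a b t *\<^sub>R q t) = (\<lambda>t. smooth_box n a b t *\<^sub>R (indicator {a..b} t *\<^sub>R q t))"
    proof
      show "smooth_box n a b t *\<^sub>R q t = smooth_box n a b t *\<^sub>R (indicator {a..b} t *\<^sub>R q t)" for t
        by (cases "t \<in> {a..b}") (auto simp: smooth_box_eq_0)
    qed
    then show "(\<lambda>t. smooth_box n a b t *\<^sub>R q t) \<in> borel_measurable lborel"
      using borel_measurable_scaleR[OF _ borel_measurable_integrable[OF I], of "smooth_box n a b"]
      by (simp only: measurable_lborel2) (use meas in auto)
    show "AE t in lborel. norm (smooth_box n a b t *\<^sub>R q t) \<le> norm (indicator {a..b} t *\<^sub>R q t)"
      using smooth_box_bounds[of n a b] smooth_box_eq_0[of _ a b n]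
      by (intro AE_I2) (auto simp: indicator_def intro!: mult_left_le_one_le)
  qed
  define m where "m n a b = (\<integral>t. smooth_box n a b t \<partial>lborel)" for n a b
  have "m 1 1 2 > 0"
  proof -
    have "m 1 1 2 \<noteq> 0"
    proof
      assume "m 1 1 2 = 0"
      then have "AE t in lborel. smooth_box 1 1 2 t = 0"
        unfolding m_def by (subst (asm) integral_nonneg_eq_0_iff_AE) (use box_int smooth_box_bounds in auto)
      then have "AE t in lborel. t \<notin> {1<..<2::real}"
        by eventually_elim (use smooth_box_pos[of _ 1 2 1] in force)
      then have "{1<..<2::real} \<in> null_sets lborel"
        by (subst (asm) AE_iff_null_sets[symmetric]) auto
      then show False by (auto simp: null_sets_def)
    qed
    moreover have "m 1 1 2 \<ge> 0" unfolding m_def by (simp add: smooth_box_bounds)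
    ultimately show ?thesis by simp
  qed
  define c where "c = (\<integral>t. smooth_box 1 1 2 t *\<^sub>R q t \<partial>lborel) /\<^sub>R m 1 1 2"
  have mc: "m 1 1 2 *\<^sub>R c = (\<integral>t. smooth_box 1 1 2 t *\<^sub>R q t \<partial>lborel)"
    using \<open>m 1 1 2 > 0\<close> by (simp add: c_def)
  have *: "(\<integral>t. smooth_box n a b t *\<^sub>R (q t - c) \<partial>lborel) = 0" if "0 < a" for n a b
  proof -
    define r where "r = m n a b / m 1 1 2"
    define \<kappa> where "\<kappa> t = smooth_box n a b t + (- r) * smooth_box 1 1 2 t" for t
    have "(\<integral>t. \<kappa> t *\<^sub>R q t \<partial>lborel) = 0"
    proof (rule weak)
      show "0 < min a 1" using that by simp
      show "Ck_on k UNIV \<kappa>" for k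
        unfolding \<kappa>_def[abs_def] by (intro Ck_on_add Ck_on_mult Ck_on_const Ck_on_smooth_box)
      show "\<kappa> t = 0" if "t \<notin> {min a 1..max b 2}" for t
      proof -
        have "t \<notin> {a<..<b}" "t \<notin> {1<..<2}" using that by auto
        from this[THEN smooth_box_eq_0] show ?thesis unfolding \<kappa>_def by (metis add_0 mult_zero_right)
      qed
      show "(\<integral>t. \<kappa> t \<partial>lborel) = 0"
        unfolding \<kappa>_def using \<open>m 1 1 2 > 0\<close>
        by (subst Bochner_Integration.integral_add) (auto simp: box_int m_def[symmetric] r_def)
    qed
    moreover have "(\<integral>t. \<kappa> t *\<^sub>R q t \<partial>lborel) =
        (\<integral>t. smooth_box n a b t *\<^sub>R q t + (- r) *\<^sub>R (smooth_box 1 1 2 t *\<^sub>R q t) \<partial>lborel)"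
      by (simp add: \<kappa>_def algebra_simps)
    moreover have "\<dots> = (\<integral>t. smooth_box n a b t *\<^sub>R q t \<partial>lborel) - r *\<^sub>R (m 1 1 2 *\<^sub>R c)"
      using boxq_int[OF that, of n b] boxq_int[of 1 1 2] \<open>m 1 1 2 > 0\<close>
      by (subst Bochner_Integration.integral_add)
         (auto simp: mc simp del: scaleR_scaleR One_nat_def)
    ultimately have "(\<integral>t. smooth_box n a b t *\<^sub>R q t \<partial>lborel) = m n a b *\<^sub>R c"
      using \<open>m 1 1 2 > 0\<close> by (simp add: r_def)
    moreover have "(\<integral>t. smooth_box n a b t *\<^sub>R c \<partial>lborel) = m n a b *\<^sub>R c"
      by (simp add: m_def box_int)
    ultimately show ?thesis
      using boxq_int[OF that, of n b] box_int[of n a b] by (auto simp: scaleR_diff_right)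
  qed
  have int_c: "integrable lborel (\<lambda>t. indicator {a<..<b} t *\<^sub>R (q t - c))" if "0 < a" for a b
  proof -
    have "set_integrable lborel {a<..<b} q"
      by (rule set_integrable_subset[OF int[OF that, of b]]) auto
    moreover have "set_integrable lborel {a<..<b} (\<lambda>_. c)"
      unfolding set_integrable_def
      by (intro integrable_scaleR_left) (auto simp: integrable_indicator_iff emeasure_lborel_box_eq
          simp flip: box_real(1))
    ultimately show ?thesis
      unfolding set_integrable_def by (simp add: scaleR_diff_right)
  qed
  have zero: "(\<integral>t. indicator {a<..<b} t *\<^sub>R (q t - c) \<partial>lborel) = 0" if "0 < a" for a b
  proof (rule LIMSEQ_unique)
    have eq: "smooth_box n a b t *\<^sub>R (q t - c) = smooth_box n a b t *\<^sub>R (indicator {a<..<b} t *\<^sub>R (q t - c))" for n t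
      using smooth_box_eq_0[of t a b n] by (auto simp: indicator_def)
    show "(\<lambda>n. \<integral>t. smooth_box n a b t *\<^sub>R (q t - c) \<partial>lborel) \<longlonglongrightarrow> (\<integral>t. indicator {a<..<b} t *\<^sub>R (q t - c) \<partial>lborel)"
    proof (rule integral_dominated_convergence)
      show "integrable lborel (\<lambda>t. norm (indicator {a<..<b} t *\<^sub>R (q t - c)))"
        using int_c[OF that] by (rule integrable_norm)
      show "AE t in lborel. (\<lambda>n. smooth_box n a b t *\<^sub>R (q t - c)) \<longlonglongrightarrow> indicator {a<..<b} t *\<^sub>R (q t - c)"
        by (intro AE_I2 tendsto_intros smooth_box_tendsto)
      show "AE t in lborel. norm (smooth_box n a b t *\<^sub>R (q t - c)) \<le> norm (indicator {a<..<b} t *\<^sub>R (q t - c))" for n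
        using smooth_box_bounds[of n a b] smooth_box_eq_0[of _ a b n]
        by (intro AE_I2) (auto simp: indicator_def intro!: mult_left_le_one_le)
      show "(\<lambda>t. smooth_box n a b t *\<^sub>R (q t - c)) \<in> borel_measurable lborel" for n
        unfolding eq by (intro borel_measurable_scaleR borel_measurable_integrable[OF int_c[OF that]]) simp
      show "(\<lambda>t. indicator {a<..<b} t *\<^sub>R (q t - c)) \<in> borel_measurable lborel"
        using borel_measurable_integrable[OF int_c[OF that]] .
    qed
    show "(\<lambda>n. \<integral>t. smooth_box n a b t *\<^sub>R (q t - c) \<partial>lborel) \<longlonglongrightarrow> 0"
      using *[OF that] by simp
  qed
  have "AE t in lborel. indicator {1 / real (Suc j)<..<real (Suc j)} t *\<^sub>R (q t - c) = 0" for j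
  proof (rule AE_0_if_integrals_0[OF int_c])
    fix a b :: real assume "a < b"
    have eq: "indicator {a<..<b} t *\<^sub>R (indicator {1 / real (Suc j)<..<real (Suc j)} t *\<^sub>R (q t - c)) =
      indicator {max a (1 / real (Suc j))<..<min b (real (Suc j))} t *\<^sub>R (q t - c)" for t
      by (auto simp: indicator_def)
    have "0 < max a (1 / real (Suc j))" by (simp add: less_max_iff_disj)
    then show "(\<integral>t. indicator {a<..<b} t *\<^sub>R (indicator {1 / real (Suc j)<..<real (Suc j)} t *\<^sub>R (q t - c)) \<partial>lborel) = 0"
      using zero[of "max a (1 / real (Suc j))" "min b (real (Suc j))"]
      by (simp only: eq)
  qed simp
  then have "AE t in lborel. \<forall>j. indicator {1 / real (Suc j)<..<real (Suc j)} t *\<^sub>R (q t - c) = 0"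
    by (subst AE_all_countable) blast
  then have "AE t in lborel. t > 0 \<longrightarrow> q t = c"
  proof eventually_elim
    case (elim t)
    show ?case
    proof
      assume "t > 0"
      obtain j where j: "t + 1 / t < real j" using reals_Archimedean2 by blast
      have "1 / t < real (Suc j)" "t < real (Suc j)"
        using j \<open>t > 0\<close> divide_pos_pos[of 1 t] by linarith+
      moreover have "1 / real (Suc j) < t"
        using \<open>1 / t < real (Suc j)\<close> \<open>t > 0\<close> by (simp add: field_simps)
      ultimately show "q t = c" using elim[rule_format, of j] by simp
    qed
  qed
  then show thesis using that by blast
qed

section \<open>The continuous radial representative\<close>

lemma integrable_pair_bound:
  fixes F :: "'a::euclidean_space \<times> 'b::euclidean_space \<Rightarrow> 'c::{banach, second_countable_topology}"
    and p :: "'a \<Rightarrow> real" and q :: "'b \<Rightarrow> real"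
  assumes F [measurable]: "F \<in> borel_measurable (lborel \<Otimes>\<^sub>M lborel)"
    and p: "integrable lborel p" and q: "integrable lborel q"
    and le: "\<And>s x. norm (F (s, x)) \<le> \<bar>p s\<bar> * \<bar>q x\<bar>"
  shows "integrable (lborel \<Otimes>\<^sub>M lborel) F"
proof (rule integrableI_bounded[OF F])
  have [measurable]: "p \<in> borel_measurable borel" "q \<in> borel_measurable borel"
    using p q by (auto dest: borel_measurable_integrable)
  have "(\<integral>\<^sup>+z. ennreal (norm (F z)) \<partial>(lborel \<Otimes>\<^sub>M lborel))
      = (\<integral>\<^sup>+s. \<integral>\<^sup>+x. ennreal (norm (F (s, x))) \<partial>lborel \<partial>lborel)"
    by (subst lborel.nn_integral_fst[symmetric]) auto
  also have "\<dots> \<le> (\<integral>\<^sup>+s. \<integral>\<^sup>+x. ennreal \<bar>p s\<bar> * ennreal \<bar>q x\<bar> \<partial>lborel \<partial>lborel)"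
    by (intro nn_integral_mono) (simp add: le ennreal_mult[symmetric] ennreal_leI)
  also have "\<dots> = (\<integral>\<^sup>+s. ennreal \<bar>p s\<bar> \<partial>lborel) * (\<integral>\<^sup>+x. ennreal \<bar>q x\<bar> \<partial>lborel)"
    by (simp add: nn_integral_cmult nn_integral_multc)
  also have "\<dots> < \<infinity>"
    using p q unfolding integrable_iff_bounded by (simp add: ennreal_mult_less_top)
  finally show "(\<integral>\<^sup>+z. ennreal (norm (F z)) \<partial>(lborel \<Otimes>\<^sub>M lborel)) < \<infinity>" .
qed

lemma norm_sum_scaleR_nth_le:
  fixes x :: "real ^ 'n::finite" and v :: "complex ^ 'n"
  shows "norm (\<Sum>i\<in>UNIV. x $ i *\<^sub>R v $ i) \<le> norm x * norm v"
proof -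
  have "norm (\<Sum>i\<in>UNIV. x $ i *\<^sub>R v $ i) \<le> (\<Sum>i\<in>UNIV. \<bar>norm (x $ i)\<bar> * \<bar>norm (v $ i)\<bar>)"
    by (rule order_trans[OF norm_sum]) simp
  also have "\<dots> \<le> norm x * norm v"
    unfolding norm_vec_def by (rule L2_set_mult_ineq)
  finally show ?thesis .
qed

lemma integral_lebesgue_eq_lborel:
  fixes f f' :: "'a::euclidean_space \<Rightarrow> 'b::{banach, second_countable_topology}"
  assumes "f \<in> borel_measurable lebesgue" "f' \<in> borel_measurable borel" "AE x in lborel. f x = f' x"
  shows "(\<integral>x. f x \<partial>lebesgue) = (\<integral>x. f' x \<partial>lborel)"
    and "integrable lebesgue f \<longleftrightarrow> integrable lborel f'"
proof -
  have f': "f' \<in> borel_measurable lebesgue" using assms(2) by (simp add: measurable_completion)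
  have ae: "AE x in lebesgue. f x = f' x" using assms(3) by (simp add: AE_completion_iff)
  have "(\<integral>x. f x \<partial>lebesgue) = (\<integral>x. f' x \<partial>lebesgue)"
    using assms(1) f' ae by (rule integral_cong_AE)
  also have "\<dots> = (\<integral>x. f' x \<partial>lborel)" using assms(2) by (simp add: integral_completion)
  finally show "(\<integral>x. f x \<partial>lebesgue) = (\<integral>x. f' x \<partial>lborel)" .
  have "integrable lebesgue f \<longleftrightarrow> integrable lebesgue f'"
    using assms(1) f' ae by (rule integrable_cong_AE)
  also have "\<dots> \<longleftrightarrow> integrable lborel f'" using assms(2) by (simp add: integrable_completion)
  finally show "integrable lebesgue f \<longleftrightarrow> integrable lborel f'" .
qed

text \<open>The integrand is bounded by a multiple of \<open>1 + \<Gamma>\<^sup>2\<close> on a shell that stays away from the origin.\<close>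
lemma radial_increment_integrable:
  fixes V :: "'a::euclidean_space \<Rightarrow> 'b::{banach, second_countable_topology}"
  assumes [measurable]: "V \<in> borel_measurable borel" "\<Gamma> \<in> borel_measurable borel"
    and V: "\<And>x. norm (V x) \<le> norm x powr (1 - m) * \<Gamma> x" and "m \<ge> 1"
    and \<Gamma>: "integrable lborel (\<lambda>x. (\<Gamma> x)\<^sup>2)" and "0 < a"
  shows "integrable lborel (\<lambda>x. indicator {a..<b} ((norm x)\<^sup>2) *\<^sub>R V x)"
proof (rule Bochner_Integration.integrable_bound)
  define M where "M = sqrt a powr (1 - m)"
  have "M \<ge> 0" by (simp add: M_def)
  let ?A = "{x::'a. a \<le> (norm x)\<^sup>2 \<and> (norm x)\<^sup>2 < b}"
  have "?A \<subseteq> cball 0 (sqrt \<bar>b\<bar>)" 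
  proof
    fix x assume "x \<in> ?A"
    then have "(norm x)\<^sup>2 \<le> \<bar>b\<bar>" by auto
    then show "x \<in> cball 0 (sqrt \<bar>b\<bar>)" using real_sqrt_le_iff[of "(norm x)\<^sup>2" "\<bar>b\<bar>"] by simp
  qed
  then have "bounded ?A" using bounded_cball bounded_subset by blast
  then have "emeasure lborel ?A < \<infinity>" by (rule emeasure_bounded_finite)
  then have "integrable lborel (indicator ?A :: 'a \<Rightarrow> real)"
    by (simp add: integrable_indicator_iff)
  then show "integrable lborel (\<lambda>x. M * (indicator ?A x + (\<Gamma> x)\<^sup>2))"
    using \<Gamma> by simp
  show "AE x in lborel. norm (indicator {a..<b} ((norm x)\<^sup>2) *\<^sub>R V x) \<le> norm (M * (indicator ?A x + (\<Gamma> x)\<^sup>2))"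
  proof (rule AE_I2)
    fix x
    show "norm (indicator {a..<b} ((norm x)\<^sup>2) *\<^sub>R V x) \<le> norm (M * (indicator ?A x + (\<Gamma> x)\<^sup>2))"
    proof (cases "x \<in> ?A")
      case True
      then have "sqrt a \<le> norm x" using real_sqrt_le_iff[of a "(norm x)\<^sup>2"] by simp
      then have *: "norm x powr (1 - m) \<le> M"
        unfolding M_def using \<open>m \<ge> 1\<close> \<open>0 < a\<close> by (intro powr_mono2') auto
      have "norm x powr (1 - m) * \<Gamma> x \<le> norm x powr (1 - m) * (1 + (\<Gamma> x)\<^sup>2)"
      proof (rule mult_left_mono)
        have "0 \<le> (\<Gamma> x - 1)\<^sup>2 + 1 + (\<Gamma> x)\<^sup>2" by simp
        then show "\<Gamma> x \<le> 1 + (\<Gamma> x)\<^sup>2" by (simp add: power2_eq_square algebra_simps)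
      qed simp
      also have "\<dots> \<le> M * (1 + (\<Gamma> x)\<^sup>2)" using * by (intro mult_right_mono) auto
      finally show ?thesis using True V[of x] \<open>M \<ge> 0\<close> by (simp add: abs_mult)
    next
      case False
      then show ?thesis by (auto simp: indicator_def)
    qed
  qed
qed measurable

text \<open>Let \<open>h\<close> be a Borel profile of \<open>f\<close> and let \<open>W(t)\<close> be \<open>1/S\<close> times the integral of
  \<open>V(x) = |x|\<^sup>-\<^sup>N x \<cdot> G(x)\<close> over the shell between \<open>|x|\<^sup>2 = 1\<close> and \<open>|x|\<^sup>2 = t\<close>; it is a primitive of the radial derivative. The weak formulation evaluates the integral of \<open>\<kappa> h\<close> and
  Fubini that of \<open>\<kappa> W\<close>, both as the same multiple of the integral of \<open>Z(|x|\<^sup>2) V(x)\<close>, for all \<open>\<kappa>\<close> of mean value zero. Hence \<open>h - W\<close> is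
  constant, and \<open>u\<close> is \<open>W\<close> plus this constant.\<close>
lemma weak_radial_representative:
  fixes f :: "real ^ 'n::finite \<Rightarrow> complex" and G :: "real ^ 'n \<Rightarrow> complex ^ 'n"
  assumes fG: "f \<in> L2" "G \<in> L2" "is_weak_gradient f G" and "radial f" and card: "CARD('n) \<ge> 2"
  defines "S \<equiv> sphere_area TYPE(real ^ 'n)" and "m \<equiv> real CARD('n)"
  obtains u \<Gamma> where "u \<in> borel_measurable borel" "\<Gamma> \<in> borel_measurable borel"
    "\<And>x. \<Gamma> x \<ge> 0"
    "AE x in lborel. f x = u ((norm x)\<^sup>2)" "AE x in lborel. norm (G x) = \<Gamma> x"
    "\<And>\<sigma> \<tau>. \<lbrakk>0 < \<sigma>; \<sigma> \<le> \<tau>\<rbrakk> \<Longrightarrow> ennreal (norm (u \<tau> - u \<sigma>)) \<le> ennreal (1 / S) *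
      (\<integral>\<^sup>+x. ennreal (indicator {\<sigma>..<\<tau>} ((norm x)\<^sup>2) * (norm x powr (1 - m) * \<Gamma> x)) \<partial>lborel)"
proof -
  have "S > 0" by (simp add: S_def sphere_area_pos)
  have m2: "m \<ge> 2" using card by (simp add: m_def)
  have f_meas [measurable]: "f \<in> borel_measurable lebesgue" and G_meas [measurable]: "G \<in> borel_measurable lebesgue"
    using fG by (auto simp: L2_def)
  obtain f' where f' [measurable]: "f' \<in> borel_measurable borel" "AE x in lborel. f x = f' x"
    using ex_borel_version[OF f_meas] by blast
  obtain G' where G' [measurable]: "G' \<in> borel_measurable borel" and GG': "AE x in lborel. G x = G' x"
    using ex_borel_version[OF G_meas] by blast
  have [measurable]: "(\<lambda>x. G' x $ i) \<in> borel_measurable borel" for i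
    using borel_measurable_continuous_on[OF continuous_on_component[OF continuous_on_id] G'] by simp
  obtain g where "AE x in lborel. f x = g (norm x)"
    using \<open>radial f\<close> by (auto simp: radial_def AE_completion_iff)
  with f'(2) have "AE x in lborel. f' x = g (norm x)" by eventually_elim simp
  then obtain h where h [measurable]: "h \<in> borel_measurable borel" "AE x in lborel. f' x = h ((norm x)\<^sup>2)"
    using radial_borel_profile[OF f'(1)] by blast
  have fh: "AE x in lborel. f x = h ((norm x)\<^sup>2)"
    using f'(2) h(2) by eventually_elim simp

  define \<Gamma> where "\<Gamma> x = norm (G' x)" for x
  define V where "V x = ((norm x)\<^sup>2 powr (- m / 2)) *\<^sub>R (\<Sum>i\<in>UNIV. x $ i *\<^sub>R G' x $ i)" for x
  have \<Gamma>_meas [measurable]: "\<Gamma> \<in> borel_measurable borel" unfolding \<Gamma>_def[abs_def] by measurable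
  have x_meas [measurable]: "(\<lambda>x::real^'n. x $ i) \<in> borel_measurable borel" for i
    by (intro borel_measurable_continuous_onI continuous_on_component continuous_on_id)
  have V_meas [measurable]: "V \<in> borel_measurable borel" unfolding V_def[abs_def] by measurable
  have V_le: "norm (V x) \<le> norm x powr (1 - m) * \<Gamma> x" for x
  proof (cases "x = 0")
    case False
    have "norm (V x) \<le> ((norm x)\<^sup>2 powr (- m / 2)) * (norm x * \<Gamma> x)"
      unfolding V_def \<Gamma>_def norm_scaleR by (auto intro!: mult_left_mono norm_sum_scaleR_nth_le)
    also have "(norm x)\<^sup>2 powr (- m / 2) = norm x powr (- m)"
      using False by (simp add: powr_powr flip: powr_numeral)
    also have "norm x powr (- m) * (norm x * \<Gamma> x) = norm x powr (1 - m) * \<Gamma> x"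
      using False powr_mult_base[of "norm x" "- m"] by (simp add: mult_ac)
    finally show ?thesis .
  qed (simp add: V_def)
  have int_\<Gamma>: "integrable lborel (\<lambda>x. (\<Gamma> x)\<^sup>2)"
  proof -
    have "AE x in lborel. (norm (G x))\<^sup>2 = (\<Gamma> x)\<^sup>2"
      using GG' by eventually_elim (simp add: \<Gamma>_def)
    then show ?thesis
      using integral_lebesgue_eq_lborel(2)[of "\<lambda>x. (norm (G x))\<^sup>2" "\<lambda>x. (\<Gamma> x)\<^sup>2"] fG(2) by (auto simp: L2_def)
  qed
  have int_V: "integrable lborel (\<lambda>x. indicator {a..<b} ((norm x)\<^sup>2) *\<^sub>R V x)" if "0 < a" for a b
    by (rule radial_increment_integrable[OF V_meas \<Gamma>_meas V_le _ int_\<Gamma> that]) (use m2 in simp)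
  have int_h: "set_integrable lborel {a..b} h" if "0 < a" for a b
  proof -
    have "AE x in lborel. (norm (f x))\<^sup>2 = (norm (h ((norm x)\<^sup>2)))\<^sup>2"
      using fh by eventually_elim simp
    then have "integrable lborel (\<lambda>x::real^'n. (norm (h ((norm x)\<^sup>2)))\<^sup>2)"
      using integral_lebesgue_eq_lborel(2)[of "\<lambda>x. (norm (f x))\<^sup>2" "\<lambda>x. (norm (h ((norm x)\<^sup>2)))\<^sup>2"] fG(1)
      by (auto simp: L2_def)
    then have I: "integrable lborel (\<lambda>t. radial_density TYPE(real^'n) t *\<^sub>R (norm (h t))\<^sup>2)"
      by (subst (asm) integrable_norm_power2[of "\<lambda>t. (norm (h t))\<^sup>2"]) auto
    define \<delta> where "\<delta> = S / 2 * a powr (m / 2 - 1)"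
    have "\<delta> > 0" using \<open>S > 0\<close> that by (simp add: \<delta>_def)
    show ?thesis unfolding set_integrable_def
    proof (rule Bochner_Integration.integrable_bound)
      show "integrable lborel (\<lambda>t. indicator {a..b} t + 1 / \<delta> * (radial_density TYPE(real^'n) t *\<^sub>R (norm (h t))\<^sup>2))"
        by (intro Bochner_Integration.integrable_add integrable_mult_right I)
           (simp add: integrable_indicator_iff emeasure_lborel_Icc_eq)
      show "AE t in lborel. norm (indicator {a..b} t *\<^sub>R h t)
          \<le> norm (indicator {a..b} t + 1 / \<delta> * (radial_density TYPE(real^'n) t *\<^sub>R (norm (h t))\<^sup>2))"
      proof (rule AE_I2)
        fix t
        show "norm (indicator {a..b} t *\<^sub>R h t)
          \<le> norm (indicator {a..b} t + 1 / \<delta> * (radial_density TYPE(real^'n) t *\<^sub>R (norm (h t))\<^sup>2))"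
        proof (cases "t \<in> {a..b}")
          case True
          have "a powr (m / 2 - 1) \<le> t powr (m / 2 - 1)"
            using True that m2 by (intro powr_mono2) auto
          then have "\<delta> \<le> radial_density TYPE(real^'n) t"
            using True that \<open>S > 0\<close> by (simp add: radial_density_def \<delta>_def S_def[symmetric] m_def)
          then have "\<delta> * (norm (h t))\<^sup>2 \<le> radial_density TYPE(real^'n) t * (norm (h t))\<^sup>2"
            by (intro mult_right_mono) auto
          then have 1: "(norm (h t))\<^sup>2 \<le> 1 / \<delta> * (radial_density TYPE(real^'n) t * (norm (h t))\<^sup>2)"
            using \<open>\<delta> > 0\<close> by (simp add: field_simps)
          have "0 \<le> (norm (h t) - 1)\<^sup>2 + 1 + (norm (h t))\<^sup>2" by simp
          then have "norm (h t) \<le> 1 + (norm (h t))\<^sup>2"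
            by (simp add: power2_eq_square algebra_simps)
          then show ?thesis using 1 True by (simp del: divide_divide_eq_left)
        qed simp
      qed
    qed measurable
  qed

  \<comment> \<open>Signed indicator of the shell between \<open>1\<close> and \<open>t\<close>; a base point away from \<open>0\<close> and \<open>\<infinity>\<close> is needed since \<open>V\<close> need
    not be integrable near either.\<close>
  define D where "D t x = (if (norm x)\<^sup>2 < t then 1 else 0) - (if (norm x)\<^sup>2 < 1 then 1 else (0::real))"
    for t and x :: "real^'n"
  have D_meas [measurable]: "(\<lambda>z. D (fst z) (snd z)) \<in> borel_measurable (borel \<Otimes>\<^sub>M borel)"
    unfolding D_def by measurable
  define W where "W t = (\<integral>x. D t x *\<^sub>R V x \<partial>lborel) /\<^sub>R S" for t
  have W_meas [measurable]: "W \<in> borel_measurable borel"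
    unfolding W_def[abs_def] D_def by measurable
  have D_le: "\<bar>D t x\<bar> \<le> indicator {min t 1..<max t 1} ((norm x)\<^sup>2)" for t x
    by (auto simp: D_def indicator_def)
  have int_DV: "integrable lborel (\<lambda>x. D t x *\<^sub>R V x)" if "t > 0" for t
  proof (rule Bochner_Integration.integrable_bound)
    show "integrable lborel (\<lambda>x. indicator {min t 1..<max t 1} ((norm x)\<^sup>2) *\<^sub>R V x)"
      by (rule int_V) (use that in auto)
    show "AE x in lborel. norm (D t x *\<^sub>R V x) \<le> norm (indicator {min t 1..<max t 1} ((norm x)\<^sup>2) *\<^sub>R V x)"
      using D_le by (intro AE_I2) (auto intro!: mult_right_mono)
  qed (unfold D_def, measurable)

  have pair_int: "integrable (lborel \<Otimes>\<^sub>M lborel) (\<lambda>(t, x). \<kappa> t *\<^sub>R (D t x *\<^sub>R V x))"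
    if [measurable]: "\<kappa> \<in> borel_measurable borel" and M: "\<And>t. \<bar>\<kappa> t\<bar> \<le> M * indicator {a..b} t" and "0 < a"
    for \<kappa> M a b
  proof (rule integrable_pair_bound)
    show "(\<lambda>(t, x). \<kappa> t *\<^sub>R (D t x *\<^sub>R V x)) \<in> borel_measurable (lborel \<Otimes>\<^sub>M lborel)"
      unfolding D_def by measurable
    show "integrable lborel (\<lambda>t. M * indicator {a..b} t)"
      by (intro integrable_mult_right) (simp add: integrable_indicator_iff emeasure_lborel_Icc_eq)
    show "integrable lborel (\<lambda>x. norm (indicator {min a 1..<max b 1} ((norm x)\<^sup>2) *\<^sub>R V x))"
      using \<open>0 < a\<close> by (intro integrable_norm int_V) auto
    fix t x
    have D1: "\<bar>D t x\<bar> \<le> indicator {min a 1..<max b 1} ((norm x)\<^sup>2)" if "t \<in> {a..b}"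
      using that by (auto simp: D_def indicator_def)
    have D2: "\<kappa> t = 0" if "t \<notin> {a..b}" using M[of t] that by simp
    show "norm (case (t, x) of (t, x) \<Rightarrow> \<kappa> t *\<^sub>R (D t x *\<^sub>R V x))
      \<le> \<bar>M * indicator {a..b} t\<bar> * \<bar>norm (indicator {min a 1..<max b 1} ((norm x)\<^sup>2) *\<^sub>R V x)\<bar>"
    proof (cases "t \<in> {a..b}")
      case True
      have "\<bar>\<kappa> t\<bar> * (\<bar>D t x\<bar> * norm (V x)) \<le> \<bar>M\<bar> * (indicator {min a 1..<max b 1} ((norm x)\<^sup>2) * norm (V x))"
        using M[of t] True D1[OF True] by (intro mult_mono mult_right_mono) auto
      then show ?thesis using True by (simp add: abs_mult mult.assoc)
    qed (use D2 in simp)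
  qed

  have int_W: "set_integrable lborel {a..b} W" if "0 < a" for a b
  proof -
    have "integrable (lborel \<Otimes>\<^sub>M lborel) (\<lambda>(t, x). indicator {a..b} t *\<^sub>R (D t x *\<^sub>R V x))"
      by (rule pair_int[where M = 1 and a = a and b = b]) (use that in auto)
    then have "integrable lborel (\<lambda>t. \<integral>x. indicator {a..b} t *\<^sub>R (D t x *\<^sub>R V x) \<partial>lborel)"
      by (rule lborel_pair.integrable_fst)
    then have "integrable lborel (\<lambda>t. (indicator {a..b} t *\<^sub>R (\<integral>x. D t x *\<^sub>R V x \<partial>lborel)) /\<^sub>R S)"
      by (intro integrable_scaleR_right) (simp del: scaleR_scaleR)
    then show ?thesis by (simp add: set_integrable_def W_def mult.commute)
  qed

  have weak: "(\<integral>t. \<kappa> t *\<^sub>R (h t - W t) \<partial>lborel) = 0"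
    if "0 < a" and \<kappa>: "\<And>k. Ck_on k UNIV \<kappa>" "\<And>t. t \<notin> {a..b} \<Longrightarrow> \<kappa> t = 0" "(\<integral>t. \<kappa> t \<partial>lborel) = 0"
    for \<kappa> a b
  proof -
    have cont: "continuous_on UNIV \<kappa>" using \<kappa>(1)[of 0] by simp
    then have [measurable]: "\<kappa> \<in> borel_measurable borel" by (rule borel_measurable_continuous_onI)
    obtain Z where Z: "\<And>t. (Z has_real_derivative \<kappa> t) (at t)" "\<And>t. t \<notin> {a..b} \<Longrightarrow> Z t = 0"
        "\<And>r. (\<integral>t. \<kappa> t * indicator {r<..} t \<partial>lborel) = - Z r"
      using compactly_supported_antiderivative[OF cont \<kappa>(2,3)] by blast
    have "continuous_on UNIV Z" using Z(1) by (auto intro!: DERIV_continuous_on DERIV_subset[OF Z(1)])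
    then have [measurable]: "Z \<in> borel_measurable borel" by (rule borel_measurable_continuous_onI)
    have "compact (\<kappa> ` {a..b})"
      by (rule compact_continuous_image[OF continuous_on_subset[OF cont]]) auto
    then obtain M where "\<forall>y\<in>\<kappa> ` {a..b}. norm y \<le> M"
      using compact_imp_bounded bounded_iff by metis
    then have M: "\<bar>\<kappa> t\<bar> \<le> M * indicator {a..b} t" for t
      using \<kappa>(2)[of t] by (cases "t \<in> {a..b}") auto
    have int_\<kappa>: "integrable lborel \<kappa>"
    proof (rule Bochner_Integration.integrable_bound)
      show "integrable lborel (\<lambda>t. M * indicator {a..b} t)"
        by (intro integrable_mult_right) (simp add: integrable_indicator_iff emeasure_lborel_Icc_eq)
      show "AE t in lborel. norm (\<kappa> t) \<le> norm (M * indicator {a..b} t)"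
        using M by (intro AE_I2) (metis abs_ge_self order_trans real_norm_def)
    qed simp
    have int_\<kappa>s: "integrable lborel (\<lambda>t. \<kappa> t *\<^sub>R w t)" if "set_integrable lborel {a..b} w" for w :: "real \<Rightarrow> complex"
    proof (rule Bochner_Integration.integrable_bound)
      have I: "integrable lborel (\<lambda>t. indicator {a..b} t *\<^sub>R w t)" using that by (simp add: set_integrable_def)
      then show "integrable lborel (\<lambda>t. M *\<^sub>R (indicator {a..b} t *\<^sub>R w t))" by (rule integrable_scaleR_right)
      have eq: "\<kappa> t *\<^sub>R w t = \<kappa> t *\<^sub>R (indicator {a..b} t *\<^sub>R w t)" for t
        using \<kappa>(2)[of t] by (cases "t \<in> {a..b}") auto
      show "(\<lambda>t. \<kappa> t *\<^sub>R w t) \<in> borel_measurable lborel"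
        unfolding eq by (intro borel_measurable_scaleR borel_measurable_integrable[OF I]) simp
      show "AE t in lborel. norm (\<kappa> t *\<^sub>R w t) \<le> norm (M *\<^sub>R (indicator {a..b} t *\<^sub>R w t))"
      proof (rule AE_I2)
        fix t
        show "norm (\<kappa> t *\<^sub>R w t) \<le> norm (M *\<^sub>R (indicator {a..b} t *\<^sub>R w t))"
          using M[of t] by (cases "t \<in> {a..b}") (auto intro!: mult_right_mono)
      qed
    qed
    have "S *\<^sub>R (\<integral>t. \<kappa> t *\<^sub>R h t \<partial>lborel) =
      (\<integral>t. radial_density TYPE(real^'n) t *\<^sub>R ((2 * t powr (1 - m / 2) * \<kappa> t) *\<^sub>R h t) \<partial>lborel)"
    proof -
      have "radial_density TYPE(real^'n) t * (2 * t powr (1 - m / 2) * \<kappa> t) = S * \<kappa> t" for t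
      proof (cases "t > 0")
        case True
        then have "t powr (m / 2 - 1) * t powr (1 - m / 2) = 1"
          by (simp flip: powr_add)
        then show ?thesis using True
          by (simp add: radial_density_def S_def[symmetric] m_def)
      next
        case False
        then show ?thesis using \<kappa>(2)[of t] \<open>0 < a\<close> by simp
      qed
      then have "radial_density TYPE(real^'n) t *\<^sub>R ((2 * t powr (1 - m / 2) * \<kappa> t) *\<^sub>R h t)
          = S *\<^sub>R (\<kappa> t *\<^sub>R h t)" for t
        by (simp only: scaleR_scaleR)
      then show ?thesis by (simp only: integral_scaleR_right)
    qed
    also have "\<dots> = (\<integral>x. (2 * (norm x)\<^sup>2 powr (1 - m / 2) * \<kappa> ((norm x)\<^sup>2)) *\<^sub>R h ((norm x)\<^sup>2) \<partial>(lborel :: (real^'n) measure))"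
      by (subst integral_norm_power2[of "\<lambda>t. (2 * t powr (1 - m / 2) * \<kappa> t) *\<^sub>R h t"]) auto
    also have "\<dots> = (\<integral>x. (2 * (norm x)\<^sup>2 powr (1 - m / 2) * \<kappa> ((norm x)\<^sup>2)) *\<^sub>R f x \<partial>lebesgue)"
    proof (rule integral_lebesgue_eq_lborel(1)[symmetric])
      show "(\<lambda>x. (2 * (norm x)\<^sup>2 powr (1 - m / 2) * \<kappa> ((norm x)\<^sup>2)) *\<^sub>R f x) \<in> borel_measurable lebesgue"
        by (intro borel_measurable_scaleR f_meas measurable_completion) measurable
      show "AE x in lborel. (2 * (norm x)\<^sup>2 powr (1 - m / 2) * \<kappa> ((norm x)\<^sup>2)) *\<^sub>R f x =
          (2 * (norm x)\<^sup>2 powr (1 - m / 2) * \<kappa> ((norm x)\<^sup>2)) *\<^sub>R h ((norm x)\<^sup>2)"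
        using fh by eventually_elim simp
    qed measurable
    also have "\<dots> = - (\<integral>x. ((norm x)\<^sup>2 powr (- m / 2) * Z ((norm x)\<^sup>2)) *\<^sub>R (\<Sum>i\<in>UNIV. x $ i *\<^sub>R G x $ i) \<partial>lebesgue)"
      unfolding m_def using weak_gradient_radial_field[OF fG \<kappa>(1,2) \<open>0 < a\<close> Z(1,2)] .
    also have "(\<integral>x. ((norm x)\<^sup>2 powr (- m / 2) * Z ((norm x)\<^sup>2)) *\<^sub>R (\<Sum>i\<in>UNIV. x $ i *\<^sub>R G x $ i) \<partial>lebesgue)
        = (\<integral>x. Z ((norm x)\<^sup>2) *\<^sub>R V x \<partial>lborel)"
    proof (rule integral_lebesgue_eq_lborel(1))
      have "(\<lambda>x. G x $ i) \<in> borel_measurable lebesgue" for i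
        using L2_component[OF fG(2), of i] by (simp add: L2_def)
      moreover have "(\<lambda>x::real^'n. (norm x)\<^sup>2 powr (- m / 2) * Z ((norm x)\<^sup>2)) \<in> borel_measurable lebesgue"
        "(\<lambda>x::real^'n. x $ i) \<in> borel_measurable lebesgue" for i
        by (rule measurable_completion; measurable)+
      ultimately show "(\<lambda>x. ((norm x)\<^sup>2 powr (- m / 2) * Z ((norm x)\<^sup>2)) *\<^sub>R (\<Sum>i\<in>UNIV. x $ i *\<^sub>R G x $ i)) \<in> borel_measurable lebesgue"
        by (intro borel_measurable_scaleR borel_measurable_sum)
      show "AE x in lborel. ((norm x)\<^sup>2 powr (- m / 2) * Z ((norm x)\<^sup>2)) *\<^sub>R (\<Sum>i\<in>UNIV. x $ i *\<^sub>R G x $ i) = Z ((norm x)\<^sup>2) *\<^sub>R V x"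
        using GG' by eventually_elim (simp add: V_def mult.commute)
    qed measurable
    finally have 1: "S *\<^sub>R (\<integral>t. \<kappa> t *\<^sub>R h t \<partial>lborel) = - (\<integral>x. Z ((norm x)\<^sup>2) *\<^sub>R V x \<partial>lborel)" .

    have inner: "(\<integral>t. \<kappa> t * D t x \<partial>lborel) = - Z ((norm x)\<^sup>2)" for x
    proof -
      have "(\<integral>t. \<kappa> t * D t x \<partial>lborel) =
        (\<integral>t. \<kappa> t * indicator {(norm x)\<^sup>2<..} t - (if (norm x)\<^sup>2 < 1 then 1 else 0) * \<kappa> t \<partial>lborel)"
        by (intro Bochner_Integration.integral_cong refl) (auto simp: D_def indicator_def)
      also have "\<dots> = - Z ((norm x)\<^sup>2) - (if (norm x)\<^sup>2 < 1 then 1 else 0) * (\<integral>t. \<kappa> t \<partial>lborel)"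
        using int_\<kappa> by (subst Bochner_Integration.integral_diff)
          (auto simp: Z(3) intro!: integrable_real_mult_indicator)
      finally show ?thesis using \<kappa>(3) by simp
    qed
    have "S *\<^sub>R (\<integral>t. \<kappa> t *\<^sub>R W t \<partial>lborel) = (\<integral>t. S *\<^sub>R (\<kappa> t *\<^sub>R W t) \<partial>lborel)"
      by (rule integral_scaleR_right[symmetric])
    also have "\<dots> = (\<integral>t. (\<integral>x. \<kappa> t *\<^sub>R (D t x *\<^sub>R V x) \<partial>lborel) \<partial>lborel)"
      using \<open>S > 0\<close> by (intro Bochner_Integration.integral_cong refl) (simp add: W_def del: scaleR_scaleR, simp)
    also have "\<dots> = (\<integral>x. (\<integral>t. \<kappa> t *\<^sub>R (D t x *\<^sub>R V x) \<partial>lborel) \<partial>lborel)"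
      by (rule lborel_pair.Fubini_integral[symmetric]) (rule pair_int[OF _ M \<open>0 < a\<close>], measurable)
    also have "\<dots> = (\<integral>x. - (Z ((norm x)\<^sup>2) *\<^sub>R V x) \<partial>lborel)"
    proof (intro Bochner_Integration.integral_cong refl)
      fix x
      have "integrable lborel (\<lambda>t. \<kappa> t * D t x)"
      proof (rule Bochner_Integration.integrable_bound[OF int_\<kappa>])
        show "AE t in lborel. norm (\<kappa> t * D t x) \<le> norm (\<kappa> t)"
          by (intro AE_I2) (auto simp: D_def)
      qed (unfold D_def, measurable)
      then have "(\<integral>t. (\<kappa> t * D t x) *\<^sub>R V x \<partial>lborel) = (\<integral>t. \<kappa> t * D t x \<partial>lborel) *\<^sub>R V x"
        by (rule integral_scaleR_left)
      then show "(\<integral>t. \<kappa> t *\<^sub>R (D t x *\<^sub>R V x) \<partial>lborel) = - (Z ((norm x)\<^sup>2) *\<^sub>R V x)"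
        by (simp add: inner)
    qed
    also have "\<dots> = - (\<integral>x. Z ((norm x)\<^sup>2) *\<^sub>R V x \<partial>lborel)" by simp
    finally have "S *\<^sub>R (\<integral>t. \<kappa> t *\<^sub>R h t \<partial>lborel) = S *\<^sub>R (\<integral>t. \<kappa> t *\<^sub>R W t \<partial>lborel)"
      using 1 by simp
    then have "(\<integral>t. \<kappa> t *\<^sub>R h t \<partial>lborel) = (\<integral>t. \<kappa> t *\<^sub>R W t \<partial>lborel)"
      using \<open>S > 0\<close> by simp
    then show ?thesis
      using int_\<kappa>s[OF int_h[OF \<open>0 < a\<close>]] int_\<kappa>s[OF int_W[OF \<open>0 < a\<close>]]
      by (simp add: scaleR_diff_right)
  qed
  have "set_integrable lborel {a..b} (\<lambda>t. h t - W t)" if "0 < a" for a b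
    using int_h[OF that] int_W[OF that] by (rule set_integral_diff)
  then obtain c where c: "AE t in lborel. t > 0 \<longrightarrow> h t - W t = c"
    using du_bois_reymond_halfline[of "\<lambda>t. h t - W t"] weak by blast
  define u where "u t = W t + c" for t
  show thesis
  proof
    show "u \<in> borel_measurable borel" unfolding u_def[abs_def] by measurable
    show "\<Gamma> \<in> borel_measurable borel" by (rule \<Gamma>_meas)
    show "\<Gamma> x \<ge> 0" for x by (simp add: \<Gamma>_def)
    have "AE t in lborel. t > 0 \<longrightarrow> h t = u t"
      using c by eventually_elim (auto simp: u_def algebra_simps)
    from AE_norm_power2[OF this, where 'a = "real^'n"] fh
    show "AE x in lborel. f x = u ((norm x)\<^sup>2)" by eventually_elim simp
    show "AE x in lborel. norm (G x) = \<Gamma> x" using GG' by eventually_elim (simp add: \<Gamma>_def)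
    fix \<sigma> \<tau> :: real assume st: "0 < \<sigma>" "\<sigma> \<le> \<tau>"
    have "u \<tau> - u \<sigma> = ((\<integral>x. D \<tau> x *\<^sub>R V x \<partial>lborel) - (\<integral>x. D \<sigma> x *\<^sub>R V x \<partial>lborel)) /\<^sub>R S"
      by (simp add: u_def W_def scaleR_diff_right)
    also have "(\<integral>x. D \<tau> x *\<^sub>R V x \<partial>lborel) - (\<integral>x. D \<sigma> x *\<^sub>R V x \<partial>lborel) =
        (\<integral>x. D \<tau> x *\<^sub>R V x - D \<sigma> x *\<^sub>R V x \<partial>lborel)"
      by (rule Bochner_Integration.integral_diff[symmetric]) (use st in \<open>auto intro!: int_DV\<close>)
    also have "\<dots> = (\<integral>x. indicator {\<sigma>..<\<tau>} ((norm x)\<^sup>2) *\<^sub>R V x \<partial>lborel)"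
      by (intro Bochner_Integration.integral_cong refl) (use st in \<open>auto simp: D_def indicator_def\<close>)
    finally have "norm (u \<tau> - u \<sigma>) = (1 / S) * norm (\<integral>x. indicator {\<sigma>..<\<tau>} ((norm x)\<^sup>2) *\<^sub>R V x \<partial>lborel)"
      using \<open>S > 0\<close> by (simp add: divide_inverse mult.commute)
    then have "ennreal (norm (u \<tau> - u \<sigma>)) = ennreal (1 / S) * ennreal (norm (\<integral>x. indicator {\<sigma>..<\<tau>} ((norm x)\<^sup>2) *\<^sub>R V x \<partial>lborel))"
      using \<open>S > 0\<close> by (simp only: ennreal_mult'[of "1 / S"] divide_nonneg_nonneg norm_ge_zero
          zero_le_one less_imp_le)
    also have "\<dots> \<le> ennreal (1 / S) * (\<integral>\<^sup>+x. ennreal (norm (indicator {\<sigma>..<\<tau>} ((norm x)\<^sup>2) *\<^sub>R V x)) \<partial>lborel)"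
      by (intro mult_left_mono integral_norm_bound_ennreal int_V st) auto
    also have "\<dots> \<le> ennreal (1 / S) *
      (\<integral>\<^sup>+x. ennreal (indicator {\<sigma>..<\<tau>} ((norm x)\<^sup>2) * (norm x powr (1 - m) * \<Gamma> x)) \<partial>lborel)"
      by (intro mult_left_mono nn_integral_mono ennreal_leI)
         (auto simp: V_le intro!: mult_left_mono)
    finally show "ennreal (norm (u \<tau> - u \<sigma>)) \<le> ennreal (1 / S) *
      (\<integral>\<^sup>+x. ennreal (indicator {\<sigma>..<\<tau>} ((norm x)\<^sup>2) * (norm x powr (1 - m) * \<Gamma> x)) \<partial>lborel)" .
  qed
qed

section \<open>Estimates for the representative\<close>

text \<open>The passage between weights in \<open>|x|\<close> and weights in the variable \<open>|x|\<^sup>2\<close>; it holds at the origin too, where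
  both sides are \<open>0\<close>.\<close>
lemma norm_power2_powr: "(norm x)\<^sup>2 powr (a / 2) = norm x powr a"
proof (cases "norm x = 0")
  case False
  then have "(norm x)\<^sup>2 = norm x powr 2" by (simp add: powr_numeral)
  then show ?thesis by (simp only: powr_powr) simp
qed simp

lemma powr_power2: "(y powr a)\<^sup>2 = y powr (2 * a)" for y a :: real
  by (simp add: power2_eq_square flip: powr_add)

lemma norm_power2_le: "(norm x)\<^sup>2 \<le> 2 * (norm y)\<^sup>2 + 2 * (norm (y - x))\<^sup>2"
proof -
  have "norm x \<le> norm y + norm (y - x)" using norm_triangle_ineq4[of y "y - x"] by simp
  then have "(norm x)\<^sup>2 \<le> (norm y + norm (y - x))\<^sup>2" by (intro power_mono) auto
  also have "\<dots> \<le> 2 * (norm y)\<^sup>2 + 2 * (norm (y - x))\<^sup>2"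
    using sum_squares_bound[of "norm y" "norm (y - x)"] by (simp add: power2_sum)
  finally show ?thesis .
qed

text \<open>The data that the estimates need: the representative \<open>u\<close>, the size \<open>\<Gamma>\<close> of the gradient, their \<open>L\<^sup>2\<close> norms, and the
  bound on increments. The sphere area \<open>S\<close> and the dimension \<open>m\<close> are parameters so that they are plain
  real numbers in the computations.\<close>
locale radial_H1_function =
  fixes u :: "real \<Rightarrow> complex" and \<Gamma> :: "real ^ 'n::finite \<Rightarrow> real" and A B S m :: real
  assumes S_eq: "S = sphere_area TYPE(real ^ 'n)" and m_eq: "m = real CARD('n)"
    and u_meas [measurable]: "u \<in> borel_measurable borel"
    and \<Gamma>_meas [measurable]: "\<Gamma> \<in> borel_measurable borel"
    and \<Gamma>_nonneg: "\<And>x. \<Gamma> x \<ge> 0"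
    and card: "CARD('n) \<ge> 2"
    and AB: "A \<ge> 0" "B \<ge> 0"
    and u_L2: "(\<integral>\<^sup>+x. ennreal ((norm (u ((norm (x :: real ^ 'n))\<^sup>2)))\<^sup>2) \<partial>lborel) = ennreal (A\<^sup>2)"
    and \<Gamma>_L2: "(\<integral>\<^sup>+x. ennreal ((\<Gamma> x)\<^sup>2) \<partial>lborel) = ennreal (B\<^sup>2)"
    and increment: "\<And>\<sigma> \<tau>. \<lbrakk>0 < \<sigma>; \<sigma> \<le> \<tau>\<rbrakk> \<Longrightarrow>
      ennreal (norm (u \<tau> - u \<sigma>)) \<le> ennreal (1 / S) *
        (\<integral>\<^sup>+x. ennreal (indicator {\<sigma>..<\<tau>} ((norm x)\<^sup>2) * (norm x powr (1 - m) * \<Gamma> x)) \<partial>lborel)"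
begin

lemma S_pos: "S > 0" unfolding S_eq by (rule sphere_area_pos)

lemma m_ge_2: "m \<ge> 2" using card by (simp add: m_eq)

lemma radial_density_eq:
  "radial_density TYPE(real ^ 'n) t = indicator {0<..} t * (S / 2 * t powr (m / 2 - 1))"
  by (simp add: radial_density_def S_eq m_eq)

text \<open>Cauchy-Schwarz, splitting \<open>|x|\<^sup>1\<^sup>-\<^sup>N \<Gamma>\<close> as a power of \<open>|x|\<close> times \<open>|x|\<^sup>\<gamma>\<^sup>-\<^sup>N\<^sup>/\<^sup>2 \<Gamma>\<close>. The exponent \<open>\<gamma>\<close> is free: \<open>\<gamma> = N/2\<close>
  leaves the \<open>L\<^sup>2\<close> norm of the gradient unweighted, and \<open>\<gamma> > 1\<close> makes the first integral converge at infinity.\<close>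
lemma increment_power2:
  assumes "0 < \<sigma>" "\<sigma> \<le> \<tau>"
  shows "ennreal ((norm (u \<tau> - u \<sigma>))\<^sup>2) \<le> ennreal (1 / (2 * S)) *
    (\<integral>\<^sup>+t. ennreal (indicator {\<sigma>..<\<tau>} t * t powr (- \<gamma>)) \<partial>lborel) *
    (\<integral>\<^sup>+x. ennreal (indicator {\<sigma>..<\<tau>} ((norm x)\<^sup>2) * ((norm x)\<^sup>2 powr (\<gamma> - m / 2) * (\<Gamma> x)\<^sup>2)) \<partial>lborel)"
proof -
  let ?i = "\<lambda>x::real^'n. indicator {\<sigma>..<\<tau>} ((norm x)\<^sup>2) :: real"
  let ?F = "\<lambda>x. ennreal (?i x * (norm x)\<^sup>2 powr (1 / 2 - m / 4 - \<gamma> / 2))"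
  let ?H = "\<lambda>x. ennreal (?i x * ((norm x)\<^sup>2 powr (\<gamma> / 2 - m / 4) * \<Gamma> x))"
  have prod: "ennreal (?i x * (norm x powr (1 - m) * \<Gamma> x)) = ?F x * ?H x" for x
  proof (cases "(norm x)\<^sup>2 \<in> {\<sigma>..<\<tau>}")
    case True
    have "(1 - m) / 2 = (1 / 2 - m / 4 - \<gamma> / 2) + (\<gamma> / 2 - m / 4)" by (simp add: field_simps)
    then have "norm x powr (1 - m) = (norm x)\<^sup>2 powr (1 / 2 - m / 4 - \<gamma> / 2) * (norm x)\<^sup>2 powr (\<gamma> / 2 - m / 4)"
      using norm_power2_powr[of x "1 - m"] by (metis powr_add)
    then show ?thesis using True by (simp add: \<Gamma>_nonneg ennreal_mult'[symmetric] mult.assoc)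
  qed simp
  have F2: "(\<integral>\<^sup>+x. (?F x)\<^sup>2 \<partial>lborel) = ennreal (S / 2) * (\<integral>\<^sup>+t. ennreal (indicator {\<sigma>..<\<tau>} t * t powr (- \<gamma>)) \<partial>lborel)"
  proof -
    have "(\<integral>\<^sup>+x. (?F x)\<^sup>2 \<partial>lborel) =
        (\<integral>\<^sup>+x. ennreal (?i x * (norm x)\<^sup>2 powr (1 - m / 2 - \<gamma>)) \<partial>(lborel :: (real^'n) measure))"
      by (intro nn_integral_cong)
         (auto simp: indicator_def ennreal_power powr_power2 right_diff_distrib)
    also have "\<dots> = (\<integral>\<^sup>+t. ennreal (radial_density TYPE(real^'n) t) * ennreal (indicator {\<sigma>..<\<tau>} t * t powr (1 - m / 2 - \<gamma>)) \<partial>lborel)"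
      by (rule nn_integral_norm_power2) measurable
    also have "\<dots> = (\<integral>\<^sup>+t. ennreal (S / 2) * ennreal (indicator {\<sigma>..<\<tau>} t * t powr (- \<gamma>)) \<partial>lborel)"
    proof (intro nn_integral_cong)
      fix t
      have "t powr (m / 2 - 1) * t powr (1 - m / 2 - \<gamma>) = t powr (- \<gamma>)" if "t > 0"
        using that by (simp flip: powr_add)
      then show "ennreal (radial_density TYPE(real^'n) t) * ennreal (indicator {\<sigma>..<\<tau>} t * t powr (1 - m / 2 - \<gamma>))
        = ennreal (S / 2) * ennreal (indicator {\<sigma>..<\<tau>} t * t powr (- \<gamma>))"
        using assms(1) S_pos by (auto simp: indicator_def radial_density_eq ennreal_mult'[symmetric])
    qed
    also have "\<dots> = ennreal (S / 2) * (\<integral>\<^sup>+t. ennreal (indicator {\<sigma>..<\<tau>} t * t powr (- \<gamma>)) \<partial>lborel)"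
      by (rule nn_integral_cmult) measurable
    finally show ?thesis .
  qed
  have H2: "(\<integral>\<^sup>+x. (?H x)\<^sup>2 \<partial>lborel) =
      (\<integral>\<^sup>+x. ennreal (?i x * ((norm x)\<^sup>2 powr (\<gamma> - m / 2) * (\<Gamma> x)\<^sup>2)) \<partial>lborel)"
    by (intro nn_integral_cong)
       (auto simp: indicator_def ennreal_power powr_power2 right_diff_distrib power_mult_distrib \<Gamma>_nonneg)
  have "ennreal ((norm (u \<tau> - u \<sigma>))\<^sup>2) = (ennreal (norm (u \<tau> - u \<sigma>)))\<^sup>2"
    by (simp add: ennreal_power)
  also have "\<dots> \<le> (ennreal (1 / S) * (\<integral>\<^sup>+x. ?F x * ?H x \<partial>lborel))\<^sup>2"
    using increment[OF assms] unfolding prod by (intro power_mono) auto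
  also have "\<dots> = ennreal (1 / S\<^sup>2) * (\<integral>\<^sup>+x. ?F x * ?H x \<partial>lborel)\<^sup>2"
    using S_pos by (simp add: power_mult_distrib ennreal_power power_divide)
  also have "\<dots> \<le> ennreal (1 / S\<^sup>2) * ((\<integral>\<^sup>+x. (?F x)\<^sup>2 \<partial>lborel) * (\<integral>\<^sup>+x. (?H x)\<^sup>2 \<partial>lborel))"
    by (intro mult_left_mono Cauchy_Schwarz_nn_integral) auto
  also have "\<dots> = (ennreal (1 / S\<^sup>2) * ennreal (S / 2)) *
    (\<integral>\<^sup>+t. ennreal (indicator {\<sigma>..<\<tau>} t * t powr (- \<gamma>)) \<partial>lborel) *
    (\<integral>\<^sup>+x. ennreal (?i x * ((norm x)\<^sup>2 powr (\<gamma> - m / 2) * (\<Gamma> x)\<^sup>2)) \<partial>lborel)"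
    unfolding F2 H2 by (simp add: mult.assoc)
  also have "ennreal (1 / S\<^sup>2) * ennreal (S / 2) = ennreal (1 / (2 * S))"
    using S_pos by (subst ennreal_mult'[symmetric]) (auto simp: power2_eq_square field_simps)
  finally show ?thesis .
qed

lemma \<Gamma>_weighted_le:
  assumes "\<And>t. t \<in> T \<Longrightarrow> w t \<le> c" "c \<ge> 0"
  shows "(\<integral>\<^sup>+x. ennreal (indicator T ((norm x)\<^sup>2) * (w ((norm x)\<^sup>2) * (\<Gamma> x)\<^sup>2)) \<partial>lborel) \<le> ennreal (c * B\<^sup>2)"
proof -
  have "(\<integral>\<^sup>+x. ennreal (indicator T ((norm x)\<^sup>2) * (w ((norm x)\<^sup>2) * (\<Gamma> x)\<^sup>2)) \<partial>lborel)
      \<le> (\<integral>\<^sup>+x. ennreal c * ennreal ((\<Gamma> x)\<^sup>2) \<partial>lborel)"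
    using assms by (intro nn_integral_mono) 
      (auto simp: indicator_def ennreal_mult'[symmetric] intro!: ennreal_leI mult_right_mono)
  also have "\<dots> = ennreal (c * B\<^sup>2)"
    using assms(2) by (simp add: nn_integral_cmult \<Gamma>_L2 ennreal_mult')
  finally show ?thesis .
qed

lemma increment_short:
  assumes "0 < \<sigma>" "\<sigma> \<le> \<tau>"
  shows "(norm (u \<tau> - u \<sigma>))\<^sup>2 \<le> \<sigma> powr (- m / 2) * (\<tau> - \<sigma>) * B\<^sup>2 / (2 * S)"
proof -
  have "(\<integral>\<^sup>+t. ennreal (indicator {\<sigma>..<\<tau>} t * t powr (- (m / 2))) \<partial>lborel)
      \<le> (\<integral>\<^sup>+t. ennreal (\<sigma> powr (- m / 2)) * indicator {\<sigma>..<\<tau>} t \<partial>lborel)"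
    using assms m_ge_2 by (intro nn_integral_mono) (auto simp: indicator_def intro!: ennreal_leI powr_mono2')
  also have "\<dots> = ennreal (\<sigma> powr (- m / 2) * (\<tau> - \<sigma>))"
    using assms by (subst nn_integral_cmult_indicator) (auto simp: ennreal_mult' emeasure_lborel_Ico)
  finally have 1: "(\<integral>\<^sup>+t. ennreal (indicator {\<sigma>..<\<tau>} t * t powr (- (m / 2))) \<partial>lborel)
     \<le> ennreal (\<sigma> powr (- m / 2) * (\<tau> - \<sigma>))" .
  have 2: "(\<integral>\<^sup>+x. ennreal (indicator {\<sigma>..<\<tau>} ((norm x)\<^sup>2) * ((norm x)\<^sup>2 powr (m / 2 - m / 2) * (\<Gamma> x)\<^sup>2)) \<partial>lborel) \<le> ennreal (1 * B\<^sup>2)"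
    by (rule \<Gamma>_weighted_le) auto
  have "ennreal ((norm (u \<tau> - u \<sigma>))\<^sup>2) \<le> ennreal (1 / (2 * S)) * ennreal (\<sigma> powr (- m / 2) * (\<tau> - \<sigma>)) * ennreal (1 * B\<^sup>2)"
    using increment_power2[OF assms, of "m / 2"] mult_mono[OF mult_left_mono[OF 1, of "ennreal (1 / (2 * S))"] 2]
    by (rule order_trans) auto
  also have "\<dots> = ennreal (\<sigma> powr (- m / 2) * (\<tau> - \<sigma>) * B\<^sup>2 / (2 * S))"
    using assms S_pos by (simp add: ennreal_mult'[symmetric])
  finally show ?thesis
    using assms S_pos by (subst (asm) ennreal_le_iff) auto
qed

lemma increment_long:
  assumes "0 < \<sigma>" "\<sigma> \<le> \<tau>" "\<gamma> > 1"
  shows "ennreal ((norm (u \<tau> - u \<sigma>))\<^sup>2) \<le> ennreal (\<sigma> powr (1 - \<gamma>) / (2 * S * (\<gamma> - 1))) *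
    (\<integral>\<^sup>+x. ennreal (indicator {\<sigma>..<\<tau>} ((norm x)\<^sup>2) * ((norm x)\<^sup>2 powr (\<gamma> - m / 2) * (\<Gamma> x)\<^sup>2)) \<partial>lborel)"
proof -
  have "(\<integral>\<^sup>+t. ennreal (indicator {\<sigma>..<\<tau>} t * t powr (- \<gamma>)) \<partial>lborel)
      \<le> (\<integral>\<^sup>+t. ennreal (t powr (- \<gamma>)) * indicator {\<sigma>..} t \<partial>lborel)"
    by (intro nn_integral_mono) (auto simp: indicator_def)
  also have "\<dots> = ennreal (- (\<sigma> powr (- \<gamma> + 1)) / (- \<gamma> + 1))"
    using assms by (intro nn_integral_has_integral_lebesgue' has_integral_powr_to_inf) auto
  also have "- (\<sigma> powr (- \<gamma> + 1)) / (- \<gamma> + 1) = \<sigma> powr (1 - \<gamma>) / (\<gamma> - 1)"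
    using assms by (simp add: field_simps)
  finally have 1: "(\<integral>\<^sup>+t. ennreal (indicator {\<sigma>..<\<tau>} t * t powr (- \<gamma>)) \<partial>lborel) \<le> ennreal (\<sigma> powr (1 - \<gamma>) / (\<gamma> - 1))" .
  have "ennreal (1 / (2 * S)) * (\<integral>\<^sup>+t. ennreal (indicator {\<sigma>..<\<tau>} t * t powr (- \<gamma>)) \<partial>lborel)
      \<le> ennreal (1 / (2 * S)) * ennreal (\<sigma> powr (1 - \<gamma>) / (\<gamma> - 1))"
    by (intro mult_left_mono 1) simp
  also have "\<dots> = ennreal (\<sigma> powr (1 - \<gamma>) / (2 * S * (\<gamma> - 1)))"
    using S_pos assms by (subst ennreal_mult'[symmetric]) auto
  finally show ?thesis
    by (intro order_trans[OF increment_power2[OF assms(1,2), of \<gamma>]] mult_right_mono) auto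
qed

text \<open>For \<open>t\<close> in \<open>[\<sigma>, \<sigma> + \<delta>]\<close> the value \<open>u(\<sigma>)\<close> differs from \<open>u(t)\<close> by an increment over a short shell. Averaging over \<open>t\<close>
  bounds the contribution of \<open>u(t)\<close> by \<open>A\<close> and that of the increment by \<open>B\<close>.\<close>
lemma decay_averaged:
  assumes "\<sigma> > 0" "\<delta> > 0"
  shows "(norm (u \<sigma>))\<^sup>2 \<le> 4 / S * (\<sigma> powr (1 - m / 2) * A\<^sup>2 / \<delta> + \<sigma> powr (- m / 2) * \<delta> * B\<^sup>2)"
proof -
  let ?I = "{\<sigma>..\<sigma> + \<delta>}"
  let ?e = "\<sigma> powr (- m / 2) * \<delta> * B\<^sup>2 / S"
  let ?k = "2 / S * \<sigma> powr (1 - m / 2)"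
  have e: "?e \<ge> 0" and k: "?k \<ge> 0" using assms S_pos by auto
  have "\<sigma> powr (m / 2 - 1) \<le> t powr (m / 2 - 1)" if "t \<in> ?I" for t
    using that assms m_ge_2 by (intro powr_mono2) auto
  moreover have "\<sigma> powr (1 - m / 2) * \<sigma> powr (m / 2 - 1) = 1" 
    using assms by (simp flip: powr_add)
  ultimately have dens: "1 \<le> ?k * radial_density TYPE(real^'n) t" if "t \<in> ?I" for t
    using that assms S_pos mult_left_mono[of "\<sigma> powr (m / 2 - 1)" "t powr (m / 2 - 1)" "\<sigma> powr (1 - m / 2)"]
    by (simp add: radial_density_eq)
  have u_int: "(\<integral>\<^sup>+t. ennreal ((norm (u t))\<^sup>2) * indicator ?I t \<partial>lborel) \<le> ennreal (?k * A\<^sup>2)"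
  proof -
    have "(\<integral>\<^sup>+t. ennreal ((norm (u t))\<^sup>2) * indicator ?I t \<partial>lborel)
      \<le> (\<integral>\<^sup>+t. ennreal ?k * (ennreal (radial_density TYPE(real^'n) t) * ennreal ((norm (u t))\<^sup>2)) \<partial>lborel)"
    proof (intro nn_integral_mono)
      fix t
      show "ennreal ((norm (u t))\<^sup>2) * indicator ?I t
        \<le> ennreal ?k * (ennreal (radial_density TYPE(real^'n) t) * ennreal ((norm (u t))\<^sup>2))"
      proof (cases "t \<in> ?I")
        case True
        have "1 * (norm (u t))\<^sup>2 \<le> ?k * radial_density TYPE(real^'n) t * (norm (u t))\<^sup>2"
          by (intro mult_right_mono dens True) auto
        then show ?thesis using True k
          by (simp only: ennreal_mult'[symmetric] radial_density_nonneg mult.assoc mult_1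
              zero_le_power2 mult_nonneg_nonneg indicator_simps mult_1_right ennreal_leI)
      qed simp
    qed
    also have "\<dots> = ennreal ?k * (\<integral>\<^sup>+t. ennreal (radial_density TYPE(real^'n) t) * ennreal ((norm (u t))\<^sup>2) \<partial>lborel)"
      by (rule nn_integral_cmult) measurable
    also have "(\<integral>\<^sup>+t. ennreal (radial_density TYPE(real^'n) t) * ennreal ((norm (u t))\<^sup>2) \<partial>lborel) = ennreal (A\<^sup>2)"
      using u_L2 by (subst (asm) nn_integral_norm_power2[of "\<lambda>t. ennreal ((norm (u t))\<^sup>2)"]) auto
    finally show ?thesis using k by (simp only: ennreal_mult' zero_le_power2)
  qed
  have "ennreal ((norm (u \<sigma>))\<^sup>2 * \<delta>) = (\<integral>\<^sup>+t. ennreal ((norm (u \<sigma>))\<^sup>2) * indicator ?I t \<partial>lborel)"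
    using assms by (subst nn_integral_cmult_indicator) (auto simp: ennreal_mult')
  also have "\<dots> \<le> (\<integral>\<^sup>+t. ennreal 2 * (ennreal ((norm (u t))\<^sup>2) * indicator ?I t) + ennreal ?e * indicator ?I t \<partial>lborel)"
  proof (intro nn_integral_mono)
    fix t
    show "ennreal ((norm (u \<sigma>))\<^sup>2) * indicator ?I t \<le>
        ennreal 2 * (ennreal ((norm (u t))\<^sup>2) * indicator ?I t) + ennreal ?e * indicator ?I t"
    proof (cases "t \<in> ?I")
      case True
      have "2 * (norm (u t - u \<sigma>))\<^sup>2 \<le> 2 * (\<sigma> powr (- m / 2) * (t - \<sigma>) * B\<^sup>2 / (2 * S))"
        using increment_short[of \<sigma> t] True assms(1) by (intro mult_left_mono) auto
      also have "\<dots> = \<sigma> powr (- m / 2) * (t - \<sigma>) * B\<^sup>2 / S" by simp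
      also have "\<dots> \<le> ?e"
        using True S_pos by (intro divide_right_mono mult_right_mono mult_left_mono) auto
      finally have "(norm (u \<sigma>))\<^sup>2 \<le> 2 * (norm (u t))\<^sup>2 + ?e"
        using norm_power2_le[of "u \<sigma>" "u t"] by simp
      then have "ennreal ((norm (u \<sigma>))\<^sup>2) \<le> ennreal (2 * (norm (u t))\<^sup>2 + ?e)"
        by (rule ennreal_leI)
      also have "\<dots> = ennreal 2 * ennreal ((norm (u t))\<^sup>2) + ennreal ?e"
        using e by (simp only: ennreal_plus ennreal_mult' zero_le_power2 mult_nonneg_nonneg zero_le_numeral)
      finally show ?thesis using True by simp
    qed simp
  qed
  also have "\<dots> = ennreal 2 * (\<integral>\<^sup>+t. ennreal ((norm (u t))\<^sup>2) * indicator ?I t \<partial>lborel) + ennreal ?e * ennreal \<delta>"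
    using assms by (subst nn_integral_add) (auto simp: nn_integral_cmult nn_integral_cmult_indicator)
  also have "\<dots> \<le> ennreal 2 * ennreal (?k * A\<^sup>2) + ennreal ?e * ennreal \<delta>"
    by (intro add_right_mono mult_left_mono u_int) simp
  also have "\<dots> = ennreal (2 * (?k * A\<^sup>2) + ?e * \<delta>)"
    by (simp only: ennreal_plus ennreal_mult' mult_nonneg_nonneg e k zero_le_power2 zero_le_numeral
        less_imp_le[OF assms(2)])
  finally have "ennreal ((norm (u \<sigma>))\<^sup>2 * \<delta>) \<le> ennreal (2 * (?k * A\<^sup>2) + ?e * \<delta>)" .
  moreover have "0 \<le> 2 * (?k * A\<^sup>2) + ?e * \<delta>"
    by (intro add_nonneg_nonneg mult_nonneg_nonneg e k) (use assms in auto)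
  ultimately have "(norm (u \<sigma>))\<^sup>2 * \<delta> \<le> 2 * (?k * A\<^sup>2) + ?e * \<delta>"
    by (metis ennreal_le_iff)
  then have "(norm (u \<sigma>))\<^sup>2 \<le> (2 * (?k * A\<^sup>2) + ?e * \<delta>) / \<delta>"
    using assms by (simp add: pos_le_divide_eq)
  also have "\<dots> = 4 / S * (\<sigma> powr (1 - m / 2) * A\<^sup>2 / \<delta>) + 1 / S * (\<sigma> powr (- m / 2) * \<delta> * B\<^sup>2)"
    using assms S_pos by (simp add: field_simps)
  also have "\<dots> \<le> 4 / S * (\<sigma> powr (1 - m / 2) * A\<^sup>2 / \<delta>) + 4 / S * (\<sigma> powr (- m / 2) * \<delta> * B\<^sup>2)"
    using assms S_pos by (intro add_left_mono mult_right_mono divide_right_mono) auto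
  finally show ?thesis by (simp add: distrib_left)
qed

lemma eq_0_if_gradient_0:
  assumes "B = 0" "\<sigma> > 0"
  shows "u \<sigma> = 0"
proof (rule ccontr)
  assume "u \<sigma> \<noteq> 0"
  then have pos: "(norm (u \<sigma>))\<^sup>2 > 0" by simp
  let ?c = "4 / S * (\<sigma> powr (1 - m / 2) * A\<^sup>2)"
  have "?c \<ge> 0" using S_pos by simp
  \<comment> \<open>For \<open>B = 0\<close> the averaging length \<open>\<delta>\<close> is unconstrained; this one is too long for a nonzero value.\<close>
  define \<delta> where "\<delta> = (?c + 1) / (norm (u \<sigma>))\<^sup>2"
  have "\<delta> > 0" using pos \<open>?c \<ge> 0\<close> by (simp add: \<delta>_def)
  from decay_averaged[OF assms(2) this] have "(norm (u \<sigma>))\<^sup>2 \<le> ?c / \<delta>"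
    by (simp add: \<open>B = 0\<close> mult.assoc)
  then have "(norm (u \<sigma>))\<^sup>2 * \<delta> \<le> ?c"
    using \<open>\<delta> > 0\<close> by (simp only: pos_le_divide_eq)
  moreover have "(norm (u \<sigma>))\<^sup>2 * \<delta> = ?c + 1" using pos by (simp add: \<delta>_def)
  ultimately show False by simp
qed

text \<open>The radial lemma of Strauss, from the length \<open>\<delta>\<close> that balances the two terms of \<open>decay_averaged\<close>.\<close>
lemma decay:
  assumes "\<sigma> > 0" "A > 0" "B > 0"
  shows "(norm (u \<sigma>))\<^sup>2 \<le> 8 / S * (\<sigma> powr ((1 - m) / 2) * (A * B))"
proof -
  define \<delta> where "\<delta> = \<sigma> powr (1 / 2) * A / B"
  have \<delta>: "\<delta> > 0" using assms by (simp add: \<delta>_def)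
  have 1: "\<sigma> powr (1 - m / 2) * A\<^sup>2 / \<delta> = \<sigma> powr ((1 - m) / 2) * (A * B)"
  proof -
    have "1 - m / 2 - 1 / 2 = (1 - m) / 2" by (simp add: field_simps)
    then have "\<sigma> powr (1 - m / 2) / \<sigma> powr (1 / 2) = \<sigma> powr ((1 - m) / 2)"
      by (metis powr_diff)
    then show ?thesis using assms by (simp add: \<delta>_def power2_eq_square field_simps)
  qed
  have 2: "\<sigma> powr (- m / 2) * \<delta> * B\<^sup>2 = \<sigma> powr ((1 - m) / 2) * (A * B)"
  proof -
    have "- m / 2 + 1 / 2 = (1 - m) / 2" by (simp add: field_simps)
    then have "\<sigma> powr (- m / 2) * \<sigma> powr (1 / 2) = \<sigma> powr ((1 - m) / 2)"
      by (metis powr_add)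
    then show ?thesis using assms by (simp add: \<delta>_def power2_eq_square field_simps)
  qed
  show ?thesis using decay_averaged[OF assms(1) \<delta>] unfolding 1 2 by (simp add: mult_ac)
qed

lemma tendsto_0:
  assumes "A > 0" "B > 0"
  shows "(u \<longlongrightarrow> 0) at_top"
proof -
  have lim: "((\<lambda>\<tau>. 8 / S * (\<tau> powr ((1 - m) / 2) * (A * B))) \<longlongrightarrow> 8 / S * (0 * (A * B))) at_top"
    using m_ge_2 by (intro tendsto_intros tendsto_neg_powr filterlim_ident) auto
  have le: "\<forall>\<^sub>F \<tau> in at_top. (norm (u \<tau>))\<^sup>2 \<le> 8 / S * (\<tau> powr ((1 - m) / 2) * (A * B))"
    using eventually_gt_at_top[of 0] by eventually_elim (rule decay[OF _ assms])
  have "((\<lambda>\<tau>. (norm (u \<tau>))\<^sup>2) \<longlongrightarrow> 0) at_top"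
    using tendsto_sandwich[OF always_eventually le tendsto_const, of 0] lim by simp
  then have "((\<lambda>\<tau>. sqrt ((norm (u \<tau>))\<^sup>2)) \<longlongrightarrow> sqrt 0) at_top"
    by (rule tendsto_real_sqrt)
  then show ?thesis by (simp add: tendsto_norm_zero_iff)
qed

text \<open>As \<open>u\<close> vanishes at infinity, its value at \<open>\<sigma>\<close> is an increment over an unbounded shell.\<close>
lemma tail_bound:
  assumes "\<sigma> > 0" "\<gamma> > 1" "A > 0" "B > 0"
  shows "ennreal ((norm (u \<sigma>))\<^sup>2) \<le> ennreal (\<sigma> powr (1 - \<gamma>) / (2 * S * (\<gamma> - 1))) *
    (\<integral>\<^sup>+x. ennreal (indicator {\<sigma>..} ((norm x)\<^sup>2) * ((norm x)\<^sup>2 powr (\<gamma> - m / 2) * (\<Gamma> x)\<^sup>2)) \<partial>lborel)"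
    (is "_ \<le> ?c * ?J")
proof (rule tendsto_upperbound)
  have "((\<lambda>\<tau>. (norm (u \<tau> - u \<sigma>))\<^sup>2) \<longlongrightarrow> (norm (0 - u \<sigma>))\<^sup>2) at_top"
    by (intro tendsto_intros tendsto_0 assms)
  then show "((\<lambda>\<tau>. ennreal ((norm (u \<tau> - u \<sigma>))\<^sup>2)) \<longlongrightarrow> ennreal ((norm (u \<sigma>))\<^sup>2)) at_top"
    by (intro tendsto_ennrealI) simp
  show "\<forall>\<^sub>F \<tau> in at_top. ennreal ((norm (u \<tau> - u \<sigma>))\<^sup>2) \<le> ?c * ?J"
    using eventually_ge_at_top[of \<sigma>]
  proof eventually_elim
    case (elim \<tau>)
    show ?case
      by (rule order_trans[OF increment_long[OF assms(1) elim assms(2)]])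
         (auto simp: indicator_def intro!: mult_left_mono nn_integral_mono)
  qed
qed simp

lemma pointwise_bound:
  assumes "\<sigma> > 0" "A > 0" "B > 0" "m > 2"
  shows "(norm (u \<sigma>))\<^sup>2 \<le> 1 / (S * (m - 2)) * (B\<^sup>2 * \<sigma> powr (1 - m / 2))"
proof -
  have 1: "(\<integral>\<^sup>+x. ennreal (indicator {\<sigma>..} ((norm x)\<^sup>2) * ((norm x)\<^sup>2 powr (m / 2 - m / 2) * (\<Gamma> x)\<^sup>2)) \<partial>lborel)
      \<le> ennreal (1 * B\<^sup>2)"
    by (rule \<Gamma>_weighted_le) auto
  have "ennreal ((norm (u \<sigma>))\<^sup>2) \<le> ennreal (\<sigma> powr (1 - m / 2) / (2 * S * (m / 2 - 1))) * ennreal (1 * B\<^sup>2)"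
    using tail_bound[OF assms(1) _ assms(2,3), of "m / 2"] assms(4) mult_left_mono[OF 1]
    by (meson order_trans divide_strict_right_mono less_divide_eq_1_pos zero_le zero_less_numeral)
  also have "\<dots> = ennreal (1 / (S * (m - 2)) * (B\<^sup>2 * \<sigma> powr (1 - m / 2)))"
    using S_pos assms(4) by (subst ennreal_mult'[symmetric]) (auto simp: field_simps)
  finally show ?thesis using S_pos assms(4) by (subst (asm) ennreal_le_iff) auto
qed

text \<open>The inequality of Hardy. Inserting \<open>tail_bound\<close> and exchanging the integrals, the inner integral of a power of \<open>t\<close>
  over \<open>{0<..|x|\<^sup>2}\<close> cancels the weight of \<open>\<Gamma>\<^sup>2\<close>. Convergence at both ends requires \<open>1 < \<gamma> < N/2\<close>, and \<open>\<gamma>\<close> is taken to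
  be the midpoint.\<close>
lemma hardy:
  assumes "A > 0" "B > 0" "m > 2"
  shows "(\<integral>\<^sup>+x. ennreal ((norm x)\<^sup>2 powr (- 1) * (norm (u ((norm x)\<^sup>2)))\<^sup>2) \<partial>(lborel :: (real ^ 'n) measure))
    \<le> ennreal (4 / (m - 2)\<^sup>2 * B\<^sup>2)"
proof -
  define \<gamma> where "\<gamma> = (1 + m / 2) / 2"
  have \<gamma>: "\<gamma> > 1" "\<gamma> - 1 = (m - 2) / 4" "m / 2 - \<gamma> = (m - 2) / 4"
    using assms(3) by (auto simp: \<gamma>_def field_simps)
  let ?k = "1 / (4 * (\<gamma> - 1))"
  let ?w = "\<lambda>x. (norm x)\<^sup>2 powr (\<gamma> - m / 2) * (\<Gamma> x)\<^sup>2"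
  have "(\<integral>\<^sup>+x. ennreal ((norm x)\<^sup>2 powr (- 1) * (norm (u ((norm x)\<^sup>2)))\<^sup>2) \<partial>(lborel :: (real ^ 'n) measure))
    = (\<integral>\<^sup>+t. ennreal (radial_density TYPE(real^'n) t) * ennreal (t powr (- 1) * (norm (u t))\<^sup>2) \<partial>lborel)"
    by (rule nn_integral_norm_power2) measurable
  also have "\<dots> \<le> (\<integral>\<^sup>+t. (\<integral>\<^sup>+x. ennreal ?k * (ennreal (?w x) *
      ennreal (indicator {0<..(norm x)\<^sup>2} t * t powr (m / 2 - \<gamma> - 1))) \<partial>lborel) \<partial>lborel)"
  proof (intro nn_integral_mono)
    fix t
    show "ennreal (radial_density TYPE(real^'n) t) * ennreal (t powr (- 1) * (norm (u t))\<^sup>2) \<le>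
      (\<integral>\<^sup>+x. ennreal ?k * (ennreal (?w x) *
        ennreal (indicator {0<..(norm x)\<^sup>2} t * t powr (m / 2 - \<gamma> - 1))) \<partial>lborel)"
    proof (cases "t > 0")
      case True
      let ?J = "\<integral>\<^sup>+x. ennreal (indicator {t..} ((norm x)\<^sup>2) * ?w x) \<partial>lborel"
      have pw: "t powr (m / 2 - 1) * t powr (- 1) * t powr (1 - \<gamma>) = t powr (m / 2 - \<gamma> - 1)"
      proof -
        have "m / 2 - 1 + - 1 + (1 - \<gamma>) = m / 2 - \<gamma> - 1" by simp
        then show ?thesis by (metis powr_add)
      qed
      have "ennreal (radial_density TYPE(real^'n) t) * ennreal (t powr (- 1) * (norm (u t))\<^sup>2)
          = ennreal (S / 2 * (t powr (m / 2 - 1) * t powr (- 1))) * ennreal ((norm (u t))\<^sup>2)"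
        using True S_pos by (simp add: radial_density_eq ennreal_mult'[symmetric] mult.assoc)
      also have "\<dots> \<le> ennreal (S / 2 * (t powr (m / 2 - 1) * t powr (- 1))) *
          (ennreal (t powr (1 - \<gamma>) / (2 * S * (\<gamma> - 1))) * ?J)"
        by (intro mult_left_mono tail_bound True \<gamma> assms) simp
      also have "\<dots> = ennreal (S / 2 * (t powr (m / 2 - 1) * t powr (- 1)) * (t powr (1 - \<gamma>) / (2 * S * (\<gamma> - 1)))) * ?J"
      proof -
        have "ennreal a * (ennreal c * J) = ennreal (a * c) * J" if "a \<ge> 0" for a c J
          using that by (simp add: ennreal_mult' mult.assoc)
        then show ?thesis using S_pos by simp
      qed
      also have "S / 2 * (t powr (m / 2 - 1) * t powr (- 1)) * (t powr (1 - \<gamma>) / (2 * S * (\<gamma> - 1))) =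
          ?k * t powr (m / 2 - \<gamma> - 1)"
      proof -
        have "S / 2 * P * (Q / (2 * S * g)) = 1 / (4 * g) * (P * Q)" if "g > 0" for P Q g :: real
          using S_pos that by (simp add: field_simps)
        then show ?thesis unfolding pw[symmetric] using \<gamma>(1) by (metis diff_gt_0_iff_gt)
      qed
      also have "ennreal (?k * t powr (m / 2 - \<gamma> - 1)) * ?J =
          (\<integral>\<^sup>+x. ennreal (?k * t powr (m / 2 - \<gamma> - 1)) * ennreal (indicator {t..} ((norm x)\<^sup>2) * ?w x) \<partial>lborel)"
        by (rule nn_integral_cmult[symmetric]) measurable
      also have "\<dots> = (\<integral>\<^sup>+x. ennreal ?k * (ennreal (?w x) *
          ennreal (indicator {0<..(norm x)\<^sup>2} t * t powr (m / 2 - \<gamma> - 1))) \<partial>lborel)"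
        using True \<gamma>(1) by (intro nn_integral_cong) (auto simp: indicator_def ennreal_mult'[symmetric] mult_ac)
      finally show ?thesis .
    qed (simp add: radial_density_eq)
  qed
  also have "\<dots> = (\<integral>\<^sup>+x. (\<integral>\<^sup>+t. ennreal ?k * (ennreal (?w x) *
      ennreal (indicator {0<..(norm x)\<^sup>2} t * t powr (m / 2 - \<gamma> - 1))) \<partial>lborel) \<partial>lborel)"
    by (rule lborel_pair.Fubini'[symmetric]) (unfold indicator_def greaterThanAtMost_iff, measurable)
  also have "\<dots> = (\<integral>\<^sup>+x. ennreal (?k / (m / 2 - \<gamma>)) * ennreal (?w x * (norm x)\<^sup>2 powr (m / 2 - \<gamma>)) \<partial>lborel)"
  proof (intro nn_integral_cong)
    fix x :: "real^'n"
    have "(\<integral>\<^sup>+t. ennreal (indicator {0<..(norm x)\<^sup>2} t * t powr (m / 2 - \<gamma> - 1)) \<partial>lborel) =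
      (\<integral>\<^sup>+t. ennreal (t powr (m / 2 - \<gamma> - 1)) * indicator {0..(norm x)\<^sup>2} t \<partial>lborel)"
      by (intro nn_integral_cong) (auto simp: indicator_def)
    also have "\<dots> = ennreal ((norm x)\<^sup>2 powr (m / 2 - \<gamma> - 1 + 1) / (m / 2 - \<gamma> - 1 + 1))"
      using \<gamma> assms(3) by (intro nn_integral_has_integral_lebesgue' has_integral_powr_from_0) auto
    finally have inner: "(\<integral>\<^sup>+t. ennreal (indicator {0<..(norm x)\<^sup>2} t * t powr (m / 2 - \<gamma> - 1)) \<partial>lborel)
        = ennreal ((norm x)\<^sup>2 powr (m / 2 - \<gamma>) / (m / 2 - \<gamma>))"
      by (simp only: diff_add_cancel)
    have "(\<integral>\<^sup>+t. ennreal ?k * (ennreal (?w x) *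
        ennreal (indicator {0<..(norm x)\<^sup>2} t * t powr (m / 2 - \<gamma> - 1))) \<partial>lborel) =
      ennreal ?k * (ennreal (?w x) * ennreal ((norm x)\<^sup>2 powr (m / 2 - \<gamma>) / (m / 2 - \<gamma>)))"
    proof -
      have c: "(\<integral>\<^sup>+t. k * (w * F t) \<partial>lborel) = k * (w * (\<integral>\<^sup>+t. F t \<partial>lborel))"
        if [measurable]: "F \<in> borel_measurable borel" for k w :: ennreal and F :: "real \<Rightarrow> ennreal"
        by (simp add: nn_integral_cmult)
      show ?thesis unfolding inner[symmetric] by (rule c) measurable
    qed
    also have "\<dots> = ennreal (?k * (?w x * ((norm x)\<^sup>2 powr (m / 2 - \<gamma>) / (m / 2 - \<gamma>))))"
      using \<gamma>(1) by (subst ennreal_mult'[symmetric], simp, subst ennreal_mult'[symmetric]) auto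
    also have "\<dots> = ennreal (?k / (m / 2 - \<gamma>) * (?w x * (norm x)\<^sup>2 powr (m / 2 - \<gamma>)))"
      by simp
    also have "\<dots> = ennreal (?k / (m / 2 - \<gamma>)) * ennreal (?w x * (norm x)\<^sup>2 powr (m / 2 - \<gamma>))"
      using \<gamma> assms(3) by (intro ennreal_mult') auto
    finally show "(\<integral>\<^sup>+t. ennreal ?k * (ennreal (?w x) *
      ennreal (indicator {0<..(norm x)\<^sup>2} t * t powr (m / 2 - \<gamma> - 1))) \<partial>lborel) =
      ennreal (?k / (m / 2 - \<gamma>)) * ennreal (?w x * (norm x)\<^sup>2 powr (m / 2 - \<gamma>))" .
  qed
  also have "\<dots> \<le> (\<integral>\<^sup>+x. ennreal (?k / (m / 2 - \<gamma>)) * ennreal ((\<Gamma> x)\<^sup>2) \<partial>lborel)"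
  proof (intro nn_integral_mono mult_left_mono ennreal_leI)
    fix x :: "real^'n"
    have "(norm x)\<^sup>2 powr (\<gamma> - m / 2) * (norm x)\<^sup>2 powr (m / 2 - \<gamma>) \<le> 1"
      by (cases "norm x = 0") (simp_all flip: powr_add)
    then have "((norm x)\<^sup>2 powr (\<gamma> - m / 2) * (norm x)\<^sup>2 powr (m / 2 - \<gamma>)) * (\<Gamma> x)\<^sup>2 \<le> 1 * (\<Gamma> x)\<^sup>2"
      by (intro mult_right_mono) auto
    then show "?w x * (norm x)\<^sup>2 powr (m / 2 - \<gamma>) \<le> (\<Gamma> x)\<^sup>2"
      by (simp add: mult_ac)
  qed simp
  also have "\<dots> = ennreal (?k / (m / 2 - \<gamma>)) * ennreal (B\<^sup>2)"
    by (simp add: nn_integral_cmult \<Gamma>_L2)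
  also have "\<dots> = ennreal (?k / (m / 2 - \<gamma>) * B\<^sup>2)"
    by (rule ennreal_mult''[symmetric]) simp
  also have "?k / (m / 2 - \<gamma>) = 4 / (m - 2)\<^sup>2"
    unfolding \<gamma>(2,3) using assms(3) by (simp add: power2_eq_square divide_simps)
  finally show ?thesis .
qed

end

section \<open>The inequality\<close>

text \<open>With the critical radius \<open>A / B\<close> inserted, these identities turn the bounds below into the powers of \<open>A\<close> and
  \<open>B\<close> in the inequality.\<close>
lemma scaling_powr:
  fixes A B :: real
  assumes "A > 0" "B > 0"
  shows "(B\<^sup>2) powr q * ((A / B)\<^sup>2) powr e = B powr (2 * q - 2 * e) * A powr (2 * e)"
    and "(A * B) powr q * ((A / B)\<^sup>2) powr e * A\<^sup>2 = B powr (q - 2 * e) * A powr (q + 2 * e + 2)"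
proof -
  have sq: "(x\<^sup>2) powr a = x powr (2 * a)" if "x > 0" for x a :: real
    using norm_power2_powr[of x "2 * a"] that by simp
  have A2: "A\<^sup>2 = A powr 2" using assms by (simp add: powr_numeral)
  have e: "((A / B)\<^sup>2) powr e = A powr (2 * e) / B powr (2 * e)"
    using assms by (simp add: sq powr_divide)
  show "(B\<^sup>2) powr q * ((A / B)\<^sup>2) powr e = B powr (2 * q - 2 * e) * A powr (2 * e)"
    unfolding e by (simp add: sq assms powr_diff)
  show "(A * B) powr q * ((A / B)\<^sup>2) powr e * A\<^sup>2 = B powr (q - 2 * e) * A powr (q + 2 * e + 2)"
    unfolding e A2 by (simp add: powr_mult powr_diff powr_add)
qed

text \<open>The first summand comes from the exterior and the second from the interior of the critical sphere.\<close>
definition gn_const :: "real \<Rightarrow> real \<Rightarrow> real \<Rightarrow> real \<Rightarrow> real" where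
  "gn_const S m b p = (8 / S) powr ((p - 1) / 2) +
    (if m > 2 then (1 / (S * (m - 2))) powr ((p - 1) / 2) * (4 / (m - 2)\<^sup>2)
     else (16 / S + (p + 1) / (S * b)) powr ((p + 1) / 2) * (S / 2))"

context radial_H1_function
begin

lemma nn_integral_le_if_pointwise:
  fixes F F' :: "real \<Rightarrow> real"
  assumes "\<And>t. t \<ge> 0 \<Longrightarrow> F t \<le> c * F' t" and "c \<ge> 0" and [measurable]: "F' \<in> borel_measurable borel"
    and "(\<integral>\<^sup>+x. ennreal (F' ((norm x)\<^sup>2)) \<partial>(lborel :: (real ^ 'n) measure)) \<le> ennreal d"
  shows "(\<integral>\<^sup>+x. ennreal (F ((norm x)\<^sup>2)) \<partial>(lborel :: (real ^ 'n) measure)) \<le> ennreal (c * d)"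
proof -
  have "(\<integral>\<^sup>+x. ennreal (F ((norm x)\<^sup>2)) \<partial>(lborel :: (real ^ 'n) measure))
      \<le> (\<integral>\<^sup>+x. ennreal c * ennreal (F' ((norm x)\<^sup>2)) \<partial>(lborel :: (real ^ 'n) measure))"
    using assms(1,2) by (intro nn_integral_mono) (simp add: ennreal_mult'[symmetric] ennreal_leI)
  also have "\<dots> = ennreal c * (\<integral>\<^sup>+x. ennreal (F' ((norm x)\<^sup>2)) \<partial>(lborel :: (real ^ 'n) measure))"
    by (rule nn_integral_cmult) measurable
  also have "\<dots> \<le> ennreal c * ennreal d"
    by (intro mult_left_mono assms) simp
  finally show ?thesis using assms(2) by (simp add: ennreal_mult')
qed

lemma powr_p_plus_1: "norm (u t) powr (p + 1) = ((norm (u t))\<^sup>2) powr ((p - 1) / 2) * (norm (u t))\<^sup>2"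
proof -
  have "norm (u t) powr (p + 1) = (norm (u t))\<^sup>2 powr ((p - 1) / 2 + 1)"
    using norm_power2_powr[of "u t" "p + 1"] by (simp add: field_simps)
  then show ?thesis by (simp add: powr_add)
qed

text \<open>The exponent \<open>e\<close> that remains on \<open>|x|\<^sup>2\<close> after the decay estimate is nonpositive by the lower bound on \<open>p\<close>, so the
  weight is largest on the critical sphere.\<close>
lemma outer_bound:
  assumes AB: "A > 0" "B > 0" and "b > 0" and p: "p > 1" "2 * b \<le> (m - 1) * (p - 1)"
  shows "(\<integral>\<^sup>+x. ennreal (indicator {(A / B)\<^sup>2..} ((norm x)\<^sup>2) *
      ((norm x)\<^sup>2 powr (b / 2) * norm (u ((norm x)\<^sup>2)) powr (p + 1))) \<partial>(lborel :: (real ^ 'n) measure))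
    \<le> ennreal ((8 / S) powr ((p - 1) / 2) *
      (B powr ((m * (p - 1) - 2 * b) / 2) * A powr ((4 + 2 * b - (m - 2) * (p - 1)) / 2)))"
proof -
  define q e \<rho> where "q = (p - 1) / 2" and "e = b / 2 + (1 - m) / 2 * q" and "\<rho> = (A / B)\<^sup>2"
  let ?c = "(8 / S) powr q * ((A * B) powr q * \<rho> powr e)"
  have q: "q > 0" using p by (simp add: q_def)
  have e: "e \<le> 0" using p by (simp add: e_def q_def field_simps)
  have \<rho>: "\<rho> > 0" using AB by (simp add: \<rho>_def)
  have "indicator {\<rho>..} t * (t powr (b / 2) * norm (u t) powr (p + 1)) \<le> ?c * (norm (u t))\<^sup>2" for t
  proof (cases "t \<in> {\<rho>..}")
    case True
    then have t: "t > 0" using \<rho> by simp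
    have "((norm (u t))\<^sup>2) powr q \<le> (8 / S * (t powr ((1 - m) / 2) * (A * B))) powr q"
      using q decay[OF t AB] by (intro powr_mono2) auto
    also have "\<dots> = (8 / S) powr q * (t powr ((1 - m) / 2 * q) * (A * B) powr q)"
      by (simp only: powr_mult powr_powr)
    finally have "t powr (b / 2) * ((norm (u t))\<^sup>2) powr q \<le>
        t powr (b / 2) * ((8 / S) powr q * (t powr ((1 - m) / 2 * q) * (A * B) powr q))"
      by (intro mult_left_mono) auto
    also have "\<dots> = (8 / S) powr q * ((A * B) powr q * t powr e)"
      by (simp add: e_def powr_add)
    also have "\<dots> \<le> ?c"
      using True \<rho> e by (intro mult_left_mono powr_mono2') auto
    finally have "t powr (b / 2) * ((norm (u t))\<^sup>2) powr q * (norm (u t))\<^sup>2 \<le> ?c * (norm (u t))\<^sup>2"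
      by (intro mult_right_mono) auto
    then show ?thesis using True by (simp add: powr_p_plus_1 q_def mult.assoc)
  qed simp
  from nn_integral_le_if_pointwise[OF this _ _ eq_refl[OF u_L2]]
  have "(\<integral>\<^sup>+x. ennreal (indicator {\<rho>..} ((norm x)\<^sup>2) *
      ((norm x)\<^sup>2 powr (b / 2) * norm (u ((norm x)\<^sup>2)) powr (p + 1))) \<partial>(lborel :: (real ^ 'n) measure))
    \<le> ennreal (?c * A\<^sup>2)" by simp
  also have "?c * A\<^sup>2 = (8 / S) powr q * (B powr (q - 2 * e) * A powr (q + 2 * e + 2))"
    unfolding scaling_powr(2)[OF AB, symmetric] \<rho>_def by (simp add: mult.assoc)
  also have "q - 2 * e = (m * (p - 1) - 2 * b) / 2"
    by (simp add: q_def e_def field_simps)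
  also have "q + 2 * e + 2 = (4 + 2 * b - (m - 2) * (p - 1)) / 2"
    by (simp add: q_def e_def field_simps)
  finally show ?thesis by (simp add: \<rho>_def q_def)
qed

text \<open>One factor \<open>|x|\<^sup>-\<^sup>2\<close> is set aside for the inequality of Hardy. The exponent \<open>e\<close> that then remains on \<open>|x|\<^sup>2\<close> is
  nonnegative by the upper bound on \<open>p\<close>.\<close>
lemma inner_bound_high_dim:
  assumes AB: "A > 0" "B > 0" and "m > 2" and "b > 0" and p: "p > 1" "(m - 2) * (p - 1) \<le> 4 + 2 * b"
  shows "(\<integral>\<^sup>+x. ennreal (indicator {..<(A / B)\<^sup>2} ((norm x)\<^sup>2) *
      ((norm x)\<^sup>2 powr (b / 2) * norm (u ((norm x)\<^sup>2)) powr (p + 1))) \<partial>(lborel :: (real ^ 'n) measure))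
    \<le> ennreal ((1 / (S * (m - 2))) powr ((p - 1) / 2) * (4 / (m - 2)\<^sup>2) *
      (B powr ((m * (p - 1) - 2 * b) / 2) * A powr ((4 + 2 * b - (m - 2) * (p - 1)) / 2)))"
proof -
  define q e \<rho> where "q = (p - 1) / 2" and "e = b / 2 + 1 + (1 - m / 2) * q" and "\<rho> = (A / B)\<^sup>2"
  let ?k = "1 / (S * (m - 2))"
  let ?c = "?k powr q * ((B\<^sup>2) powr q * \<rho> powr e)"
  have q: "q > 0" using p by (simp add: q_def)
  have e: "e \<ge> 0" using p by (simp add: e_def q_def field_simps)
  have "indicator {..<\<rho>} t * (t powr (b / 2) * norm (u t) powr (p + 1)) \<le> ?c * (t powr (- 1) * (norm (u t))\<^sup>2)"
    if "t \<ge> 0" for t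
  proof (cases "t \<in> {0<..<\<rho>}")
    case True
    then have t: "t > 0" "t < \<rho>" by auto
    have "((norm (u t))\<^sup>2) powr q \<le> (?k * (B\<^sup>2 * t powr (1 - m / 2))) powr q"
      using q pointwise_bound[OF t(1) AB \<open>m > 2\<close>] by (intro powr_mono2) auto
    also have "\<dots> = ?k powr q * ((B\<^sup>2) powr q * t powr ((1 - m / 2) * q))"
      by (simp only: powr_mult powr_powr)
    finally have "t powr (b / 2) * ((norm (u t))\<^sup>2) powr q \<le>
        t powr (b / 2) * (?k powr q * ((B\<^sup>2) powr q * t powr ((1 - m / 2) * q)))"
      by (intro mult_left_mono) auto
    also have "\<dots> = ?k powr q * ((B\<^sup>2) powr q * (t powr (b / 2) * t powr ((1 - m / 2) * q)))"
      by simp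
    also have "t powr (b / 2) * t powr ((1 - m / 2) * q) = t powr e * t powr (- 1)"
    proof -
      have "b / 2 + (1 - m / 2) * q = e + - 1" by (simp add: e_def)
      then show ?thesis by (metis powr_add)
    qed
    also have "?k powr q * ((B\<^sup>2) powr q * (t powr e * t powr (- 1))) \<le> ?k powr q * ((B\<^sup>2) powr q * (\<rho> powr e * t powr (- 1)))"
      using t e by (intro mult_left_mono mult_right_mono powr_mono2) auto
    finally have "t powr (b / 2) * ((norm (u t))\<^sup>2) powr q * (norm (u t))\<^sup>2 \<le>
        ?k powr q * ((B\<^sup>2) powr q * (\<rho> powr e * t powr (- 1))) * (norm (u t))\<^sup>2"
      by (intro mult_right_mono) auto
    then show ?thesis using t by (simp add: powr_p_plus_1 q_def mult.assoc)
  next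
    case False
    then show ?thesis using that by (cases "t = 0") auto
  qed
  from nn_integral_le_if_pointwise[OF this _ _ hardy[OF AB \<open>m > 2\<close>]]
  have "(\<integral>\<^sup>+x. ennreal (indicator {..<\<rho>} ((norm x)\<^sup>2) *
      ((norm x)\<^sup>2 powr (b / 2) * norm (u ((norm x)\<^sup>2)) powr (p + 1))) \<partial>(lborel :: (real ^ 'n) measure))
    \<le> ennreal (?c * (4 / (m - 2)\<^sup>2 * B\<^sup>2))" by simp
  also have "?c * (4 / (m - 2)\<^sup>2 * B\<^sup>2) = ?k powr q * (4 / (m - 2)\<^sup>2) * ((B\<^sup>2) powr (q + 1) * \<rho> powr e)"
    by (simp add: powr_add)
  also have "(B\<^sup>2) powr (q + 1) * \<rho> powr e = B powr (2 * (q + 1) - 2 * e) * A powr (2 * e)"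
    unfolding \<rho>_def by (rule scaling_powr(1)[OF AB])
  also have "2 * (q + 1) - 2 * e = (m * (p - 1) - 2 * b) / 2"
    by (simp add: q_def e_def field_simps)
  also have "2 * e = (4 + 2 * b - (m - 2) * (p - 1)) / 2"
    by (simp add: q_def e_def field_simps)
  finally show ?thesis by (simp add: \<rho>_def q_def)
qed

text \<open>Inside the critical sphere \<open>u(t)\<close> is compared with the value \<open>u(\<rho>)\<close> on it, which the decay estimate bounds
  by a multiple of \<open>B\<close>. The increment between \<open>t\<close> and \<open>\<rho>\<close> is estimated with \<open>\<gamma> = 1 + \<epsilon>\<close>, and the choice
  \<open>\<epsilon> = b / (p + 1)\<close> turns the resulting growth of \<open>|u|\<^sup>p\<^sup>+\<^sup>1\<close> into exactly \<open>|x|\<^sup>-\<^sup>b\<close>.\<close>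
lemma inner_bound_dim_2:
  assumes AB: "A > 0" "B > 0" and m: "m = 2" and "b > 0" and p: "p > 1"
  shows "(\<integral>\<^sup>+x. ennreal (indicator {..<(A / B)\<^sup>2} ((norm x)\<^sup>2) *
      ((norm x)\<^sup>2 powr (b / 2) * norm (u ((norm x)\<^sup>2)) powr (p + 1))) \<partial>(lborel :: (real ^ 'n) measure))
    \<le> ennreal ((16 / S + (p + 1) / (S * b)) powr ((p + 1) / 2) * (S / 2) *
      (B powr ((m * (p - 1) - 2 * b) / 2) * A powr ((4 + 2 * b - (m - 2) * (p - 1)) / 2)))"
proof -
  define q \<epsilon> \<rho> where "q = (p + 1) / 2" and "\<epsilon> = b / (p + 1)" and "\<rho> = (A / B)\<^sup>2"
  let ?k = "16 / S + (p + 1) / (S * b)"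
  let ?c = "?k powr q * ((B\<^sup>2) powr q * \<rho> powr (b / 2))"
  have q: "q > 0" using p by (simp add: q_def)
  have \<epsilon>: "\<epsilon> > 0" using p \<open>b > 0\<close> by (simp add: \<epsilon>_def)
  have \<rho>: "\<rho> > 0" using AB by (simp add: \<rho>_def)
  have bound: "(norm (u t))\<^sup>2 \<le> ?k * (B\<^sup>2 * (\<rho> / t) powr \<epsilon>)" if t: "0 < t" "t < \<rho>" for t
  proof -
    have "(\<integral>\<^sup>+x. ennreal (indicator {t..<\<rho>} ((norm x)\<^sup>2) * ((norm x)\<^sup>2 powr (1 + \<epsilon> - m / 2) * (\<Gamma> x)\<^sup>2)) \<partial>lborel)
        \<le> ennreal (\<rho> powr \<epsilon> * B\<^sup>2)"
      by (rule \<Gamma>_weighted_le) (use t \<epsilon> in \<open>auto simp: m intro!: powr_mono2\<close>)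
    then have "ennreal (t powr (1 - (1 + \<epsilon>)) / (2 * S * (1 + \<epsilon> - 1))) *
        (\<integral>\<^sup>+x. ennreal (indicator {t..<\<rho>} ((norm x)\<^sup>2) * ((norm x)\<^sup>2 powr (1 + \<epsilon> - m / 2) * (\<Gamma> x)\<^sup>2)) \<partial>lborel)
      \<le> ennreal (t powr (1 - (1 + \<epsilon>)) / (2 * S * (1 + \<epsilon> - 1))) * ennreal (\<rho> powr \<epsilon> * B\<^sup>2)"
      by (intro mult_left_mono) auto
    then have "ennreal ((norm (u \<rho> - u t))\<^sup>2) \<le> ennreal (t powr (1 - (1 + \<epsilon>)) / (2 * S * (1 + \<epsilon> - 1))) * ennreal (\<rho> powr \<epsilon> * B\<^sup>2)"
      by (rule order_trans[OF increment_long, rotated -1]) (use t \<epsilon> in auto)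
    also have "\<dots> = ennreal (t powr (1 - (1 + \<epsilon>)) / (2 * S * (1 + \<epsilon> - 1)) * (\<rho> powr \<epsilon> * B\<^sup>2))"
      by (rule ennreal_mult''[symmetric]) simp
    finally have "(norm (u \<rho> - u t))\<^sup>2 \<le> t powr (1 - (1 + \<epsilon>)) / (2 * S * (1 + \<epsilon> - 1)) * (\<rho> powr \<epsilon> * B\<^sup>2)"
      using S_pos \<epsilon> by (subst (asm) ennreal_le_iff) auto
    also have "\<dots> = (p + 1) / (2 * S * b) * (B\<^sup>2 * (\<rho> / t) powr \<epsilon>)"
      using p by (simp add: powr_divide powr_minus \<epsilon>_def field_simps)
    finally have 1: "(norm (u \<rho> - u t))\<^sup>2 \<le> (p + 1) / (2 * S * b) * (B\<^sup>2 * (\<rho> / t) powr \<epsilon>)" .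
    have "\<rho> powr ((1 - m) / 2) * (A * B) = B\<^sup>2"
    proof -
      have "\<rho> powr ((1 - m) / 2) = (A / B) powr (- 1)"
        using norm_power2_powr[of "A / B" "- 1"] AB by (simp add: \<rho>_def m)
      then show ?thesis using AB by (simp add: powr_minus power2_eq_square)
    qed
    then have 2: "(norm (u \<rho>))\<^sup>2 \<le> 8 / S * B\<^sup>2"
      using decay[OF \<rho> AB] by simp
    have "1 \<le> (\<rho> / t) powr \<epsilon>" using t \<epsilon> by (intro ge_one_powr_ge_zero) auto
    then have "8 / S * B\<^sup>2 * 1 \<le> 8 / S * B\<^sup>2 * (\<rho> / t) powr \<epsilon>"
      using S_pos by (intro mult_left_mono) auto
    with 2 have 3: "(norm (u \<rho>))\<^sup>2 \<le> 8 / S * (B\<^sup>2 * (\<rho> / t) powr \<epsilon>)" by simp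
    have "(norm (u t))\<^sup>2 \<le> 2 * (8 / S * (B\<^sup>2 * (\<rho> / t) powr \<epsilon>)) + 2 * ((p + 1) / (2 * S * b) * (B\<^sup>2 * (\<rho> / t) powr \<epsilon>))"
      using norm_power2_le[of "u t" "u \<rho>"] 1 3 by linarith
    also have "\<dots> = ?k * (B\<^sup>2 * (\<rho> / t) powr \<epsilon>)"
      using S_pos \<open>b > 0\<close> by (simp add: field_simps)
    finally show ?thesis .
  qed
  have le: "indicator {..<\<rho>} t * (t powr (b / 2) * norm (u t) powr (p + 1)) \<le> ?c * indicator {..<\<rho>} t"
    if "t \<ge> 0" for t
  proof (cases "t \<in> {0<..<\<rho>}")
    case True
    then have t: "0 < t" "t < \<rho>" by auto
    have "norm (u t) powr (p + 1) = ((norm (u t))\<^sup>2) powr q"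
      unfolding q_def by (rule norm_power2_powr[symmetric])
    also have "\<dots> \<le> (?k * (B\<^sup>2 * (\<rho> / t) powr \<epsilon>)) powr q"
      using q bound[OF t] by (intro powr_mono2) auto
    also have "\<dots> = ?k powr q * ((B\<^sup>2) powr q * (\<rho> / t) powr (\<epsilon> * q))"
      by (simp only: powr_mult powr_powr)
    also have "\<epsilon> * q = b / 2" using p by (simp add: \<epsilon>_def q_def)
    finally have "t powr (b / 2) * norm (u t) powr (p + 1) \<le>
        t powr (b / 2) * (?k powr q * ((B\<^sup>2) powr q * (\<rho> / t) powr (b / 2)))"
      by (intro mult_left_mono) auto
    also have "\<dots> = ?c" using t by (simp add: powr_divide)
    finally show ?thesis using t by simp
  next
    case False
    then show ?thesis using that by (cases "t = 0") auto
  qed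
  have vol: "(\<integral>\<^sup>+x. ennreal (indicator {..<\<rho>} ((norm x)\<^sup>2)) \<partial>(lborel :: (real ^ 'n) measure)) \<le> ennreal (S / 2 * \<rho>)"
  proof -
    have "(\<integral>\<^sup>+x. ennreal (indicator {..<\<rho>} ((norm x)\<^sup>2)) \<partial>(lborel :: (real ^ 'n) measure))
      = (\<integral>\<^sup>+t. ennreal (radial_density TYPE(real^'n) t) * ennreal (indicator {..<\<rho>} t) \<partial>lborel)"
      by (rule nn_integral_norm_power2) measurable
    also have "\<dots> = (\<integral>\<^sup>+t. ennreal (S / 2) * indicator {0<..<\<rho>} t \<partial>lborel)"
      by (intro nn_integral_cong) (auto simp: radial_density_eq m indicator_def)
    also have "\<dots> = ennreal (S / 2 * \<rho>)"
      using \<rho> S_pos by (subst nn_integral_cmult_indicator) (auto simp: ennreal_mult'[symmetric])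
    finally show ?thesis by simp
  qed
  have "(\<integral>\<^sup>+x. ennreal (indicator {..<\<rho>} ((norm x)\<^sup>2) *
      ((norm x)\<^sup>2 powr (b / 2) * norm (u ((norm x)\<^sup>2)) powr (p + 1))) \<partial>(lborel :: (real ^ 'n) measure))
    \<le> ennreal (?c * (S / 2 * \<rho>))"
    by (rule nn_integral_le_if_pointwise[where F' = "indicator {..<\<rho>}", OF le _ _ vol]) simp_all
  also have "?c * (S / 2 * \<rho>) = ?k powr q * (S / 2) * ((B\<^sup>2) powr q * \<rho> powr (b / 2 + 1))"
    using \<rho> by (simp add: powr_add)
  also have "(B\<^sup>2) powr q * \<rho> powr (b / 2 + 1) = B powr (2 * q - 2 * (b / 2 + 1)) * A powr (2 * (b / 2 + 1))"
    unfolding \<rho>_def by (rule scaling_powr(1)[OF AB])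
  also have "2 * q - 2 * (b / 2 + 1) = (m * (p - 1) - 2 * b) / 2"
    by (simp add: q_def m field_simps)
  also have "2 * (b / 2 + 1) = (4 + 2 * b - (m - 2) * (p - 1)) / 2"
    by (simp add: m field_simps)
  finally show ?thesis by (simp add: \<rho>_def q_def)
qed

text \<open>If one of the norms is zero there is no critical radius, but then the function vanishes: a constant in \<open>L\<^sup>2\<close> is
  zero.\<close>
lemma AE_0_if_degenerate:
  assumes "A = 0 \<or> B = 0"
  shows "AE x in (lborel :: (real ^ 'n) measure). u ((norm x)\<^sup>2) = 0"
proof (cases "B = 0")
  case True
  show ?thesis
    using AE_lborel_singleton[of "0 :: real ^ 'n"]
    by eventually_elim (use True eq_0_if_gradient_0 in simp)
next
  case False
  then have "(\<integral>\<^sup>+x. ennreal ((norm (u ((norm (x :: real ^ 'n))\<^sup>2)))\<^sup>2) \<partial>lborel) = 0"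
    using assms u_L2 by simp
  then show ?thesis
    by (subst (asm) nn_integral_0_iff_AE) auto
qed

lemma weighted_gagliardo_nirenberg:
  assumes "b > 0" and p: "p > 1" "2 * b \<le> (m - 1) * (p - 1)" "(m - 2) * (p - 1) \<le> 4 + 2 * b"
  shows "(\<integral>\<^sup>+x. ennreal (norm x powr b * norm (u ((norm x)\<^sup>2)) powr (p + 1)) \<partial>(lborel :: (real ^ 'n) measure))
    \<le> ennreal (gn_const S m b p * B powr ((m * (p - 1) - 2 * b) / 2) * A powr ((4 + 2 * b - (m - 2) * (p - 1)) / 2))"
proof (cases "A = 0 \<or> B = 0")
  case True
  have "(\<integral>\<^sup>+x. ennreal (norm x powr b * norm (u ((norm x)\<^sup>2)) powr (p + 1)) \<partial>(lborel :: (real ^ 'n) measure)) =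
    (\<integral>\<^sup>+x. 0 \<partial>(lborel :: (real ^ 'n) measure))"
    using AE_0_if_degenerate[OF True] by (intro nn_integral_cong_AE) (auto elim!: eventually_mono)
  then show ?thesis by simp
next
  case False
  then have AB: "A > 0" "B > 0" using AB by auto
  let ?T = "B powr ((m * (p - 1) - 2 * b) / 2) * A powr ((4 + 2 * b - (m - 2) * (p - 1)) / 2)"
  let ?f = "\<lambda>x::real^'n. (norm x)\<^sup>2 powr (b / 2) * norm (u ((norm x)\<^sup>2)) powr (p + 1)"
  let ?c1 = "(8 / S) powr ((p - 1) / 2)" and ?c2 = "gn_const S m b p - (8 / S) powr ((p - 1) / 2)"
  have c2: "?c2 \<ge> 0" using S_pos by (simp add: gn_const_def)
  have inner: "(\<integral>\<^sup>+x. ennreal (indicator {..<(A / B)\<^sup>2} ((norm x)\<^sup>2) * ?f x) \<partial>lborel) \<le> ennreal (?c2 * ?T)"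
  proof (cases "m > 2")
    case True
    then show ?thesis
      using inner_bound_high_dim[OF AB True \<open>b > 0\<close> p(1,3)] by (simp add: gn_const_def)
  next
    case False
    then have "m = 2" using m_ge_2 by simp
    then show ?thesis
      using inner_bound_dim_2[OF AB _ \<open>b > 0\<close> p(1)] by (simp add: gn_const_def)
  qed
  have "(\<integral>\<^sup>+x. ennreal (norm x powr b * norm (u ((norm x)\<^sup>2)) powr (p + 1)) \<partial>(lborel :: (real ^ 'n) measure)) =
    (\<integral>\<^sup>+x. ennreal (indicator {(A / B)\<^sup>2..} ((norm x)\<^sup>2) * ?f x) + ennreal (indicator {..<(A / B)\<^sup>2} ((norm x)\<^sup>2) * ?f x) \<partial>lborel)"
    by (intro nn_integral_cong) (auto simp: indicator_def norm_power2_powr)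
  also have "\<dots> = (\<integral>\<^sup>+x. ennreal (indicator {(A / B)\<^sup>2..} ((norm x)\<^sup>2) * ?f x) \<partial>lborel) +
      (\<integral>\<^sup>+x. ennreal (indicator {..<(A / B)\<^sup>2} ((norm x)\<^sup>2) * ?f x) \<partial>lborel)"
    by (rule nn_integral_add) measurable
  also have "\<dots> \<le> ennreal (?c1 * ?T) + ennreal (?c2 * ?T)"
    by (intro add_mono inner outer_bound[OF AB \<open>b > 0\<close> p(1,2)])
  also have "\<dots> = ennreal (?c1 * ?T + ?c2 * ?T)"
    by (rule ennreal_plus[symmetric]) (intro mult_nonneg_nonneg c2 powr_ge_zero)+
  also have "?c1 * ?T + ?c2 * ?T = gn_const S m b p * ?T"
    by (simp only: distrib_right[symmetric]) simp
  finally show ?thesis by (simp only: mult.assoc)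
qed

end

theorem lemma2p4:
  fixes b p :: real
  assumes "CARD('n::finite) \<ge> 2"
    and "b > 0"
    and "p \<ge> 1 + 2 * b / (real CARD('n) - 1)"
    and "CARD('n) \<ge> 3 \<Longrightarrow> p \<le> (real CARD('n) + 2 + 2 * b) / (real CARD('n) - 2)"
  shows "\<exists>C>0. \<forall>f \<in> (H1_rad :: (real ^ 'n \<Rightarrow> complex) set).
    (\<integral>\<^sup>+x. ennreal (norm x powr b * norm (f x) powr (p + 1)) \<partial>lebesgue)
      \<le> ennreal (C * L2_norm (weak_gradient f) powr ((real CARD('n) * (p - 1) - 2 * b) / 2)
                   * L2_norm f powr ((4 + 2 * b - (real CARD('n) - 2) * (p - 1)) / 2))"
proof -
  define S where "S = sphere_area TYPE(real ^ 'n)"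
  define m where "m = real CARD('n)"
  have m2: "m \<ge> 2" using assms(1) by (simp add: m_def)
  have S: "S > 0" by (simp add: S_def sphere_area_pos)
  have p2: "2 * b \<le> (m - 1) * (p - 1)"
    using assms(3) m2 by (simp add: m_def[symmetric] field_simps)
  have "0 < 2 * b / (m - 1)" using \<open>b > 0\<close> m2 by simp
  then have p1: "p > 1" using assms(3) unfolding m_def by linarith
  have p3: "(m - 2) * (p - 1) \<le> 4 + 2 * b"
  proof (cases "CARD('n) \<ge> 3")
    case True
    then have "m - 2 > 0" by (simp add: m_def)
    then show ?thesis using assms(4)[OF True] by (simp add: m_def[symmetric] field_simps)
  next
    case False
    then have "m = 2" using assms(1) by (simp add: m_def)
    then show ?thesis using \<open>b > 0\<close> by simp
  qed
  define C where "C = gn_const S m b p"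
  show ?thesis
  proof (intro exI[of _ C] conjI ballI)
    have "(8 / S) powr ((p - 1) / 2) > 0" using S by simp
    then show "C > 0" using S m2 unfolding C_def gn_const_def by (auto intro!: add_pos_nonneg)
    fix f :: "real ^ 'n \<Rightarrow> complex" assume "f \<in> H1_rad"
    then have f: "f \<in> L2" "radial f" "\<exists>G. G \<in> L2 \<and> is_weak_gradient f G"
      by (auto simp: H1_rad_def H1_def)
    let ?G = "weak_gradient f"
    have G: "?G \<in> L2" "is_weak_gradient f ?G"
      using someI_ex[OF f(3)] by (auto simp: weak_gradient_def)
    obtain u \<Gamma> where u: "u \<in> borel_measurable borel" "\<Gamma> \<in> borel_measurable borel"
      "\<And>x. \<Gamma> x \<ge> 0"
      "AE x in lborel. f x = u ((norm x)\<^sup>2)" "AE x in lborel. norm (?G x) = \<Gamma> x"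
      "\<And>\<sigma> \<tau>. \<lbrakk>0 < \<sigma>; \<sigma> \<le> \<tau>\<rbrakk> \<Longrightarrow> ennreal (norm (u \<tau> - u \<sigma>)) \<le> ennreal (1 / S) *
        (\<integral>\<^sup>+x. ennreal (indicator {\<sigma>..<\<tau>} ((norm x)\<^sup>2) * (norm x powr (1 - m) * \<Gamma> x)) \<partial>lborel)"
      using weak_radial_representative[OF f(1) G f(2) assms(1)] unfolding S_def m_def by blast
    note [measurable] = u(1,2)
    have L2: "(\<integral>\<^sup>+x. ennreal ((norm (h x))\<^sup>2) \<partial>lebesgue) = ennreal ((L2_norm h)\<^sup>2)"
      if "h \<in> L2" for h :: "real ^ 'n \<Rightarrow> 'b::euclidean_space"
      using that by (subst nn_integral_eq_integral) (auto simp: L2_def L2_norm_def)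
    have nn: "(\<integral>\<^sup>+x. F x \<partial>lebesgue) = (\<integral>\<^sup>+x. F' x \<partial>lborel)"
      if "AE x in lborel. F x = F' x" "F' \<in> borel_measurable borel" for F F' :: "real ^ 'n \<Rightarrow> ennreal"
    proof -
      have "(\<integral>\<^sup>+x. F x \<partial>lebesgue) = (\<integral>\<^sup>+x. F' x \<partial>lebesgue)"
        using that(1) by (intro nn_integral_cong_AE) (simp add: AE_completion_iff)
      then show ?thesis using that(2) by (simp add: nn_integral_completion)
    qed
    interpret radial_H1_function u \<Gamma> "L2_norm f" "L2_norm ?G" S m
    proof
      show "(\<integral>\<^sup>+x. ennreal ((norm (u ((norm (x :: real ^ 'n))\<^sup>2)))\<^sup>2) \<partial>lborel) = ennreal ((L2_norm f)\<^sup>2)"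
        unfolding L2[OF f(1), symmetric] 
        by (rule nn[symmetric]) (use u(4) in \<open>auto elim!: eventually_mono\<close>)
      show "(\<integral>\<^sup>+x. ennreal ((\<Gamma> x)\<^sup>2) \<partial>lborel) = ennreal ((L2_norm ?G)\<^sup>2)"
        unfolding L2[OF G(1), symmetric] 
        by (rule nn[symmetric]) (use u(5) in \<open>auto elim!: eventually_mono\<close>)
    qed (use u assms(1) in \<open>auto simp: S_def m_def L2_norm_def\<close>)
    have "(\<integral>\<^sup>+x. ennreal (norm x powr b * norm (f x) powr (p + 1)) \<partial>lebesgue) =
      (\<integral>\<^sup>+x. ennreal (norm x powr b * norm (u ((norm x)\<^sup>2)) powr (p + 1)) \<partial>(lborel :: (real ^ 'n) measure))"
      by (rule nn) (use u(4) in \<open>auto elim!: eventually_mono\<close>)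
    also have "\<dots> \<le> ennreal (C * L2_norm ?G powr ((m * (p - 1) - 2 * b) / 2)
        * L2_norm f powr ((4 + 2 * b - (m - 2) * (p - 1)) / 2))"
      unfolding C_def by (rule weighted_gagliardo_nirenberg[OF \<open>b > 0\<close> p1 p2 p3])
    finally show "(\<integral>\<^sup>+x. ennreal (norm x powr b * norm (f x) powr (p + 1)) \<partial>lebesgue)
      \<le> ennreal (C * L2_norm ?G powr ((real CARD('n) * (p - 1) - 2 * b) / 2)
                   * L2_norm f powr ((4 + 2 * b - (real CARD('n) - 2) * (p - 1)) / 2))"
      by (simp add: m_def)
  qed
qed

end
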